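(* Let $k:\mathcal P\otimes\mathcal Q\to\mathbb R$ be differentiable at $P_0\otimes Q_0$ with canonical gradient $\widetilde k=\widetilde k_1\circ\pi_1+\widetilde k_2\circ\pi_2$, $\int\widetilde k^2\,dP_0\otimes Q_0\neq0$, and let $\alpha\in(0,1)$. Let $(n_1)_n,(n_2)_n\subset\mathbb N$ satisfy $n_1+n_2=n$ for all $n$ and $\lim_{n\to\infty}\frac{n_2}n=d\in(0,1)$. Put $$\sigma_1=\Bigl(\frac1{1-d}\int\widetilde k_1^2\,dP_0+\frac1d\int\widetilde k_2^2\,dQ_0\Bigr)^{1/2},\qquad T_n=\frac{\sqrt n}{n_1}\sum_{i=1}^{n_1}\widetilde k_1(\omega_{1,i})+\frac{\sqrt n}{n_2}\sum_{j=1}^{n_2}\widetilde k_2(\omega_{2,j}),$$ and let $\psi_n=1$ if $|T_n|>u_{1-\alpha/2}\,\sigma_1$ and $\psi_n=0$ otherwise. Let $(P_{t_n}\otimes Q_{t_n})_n\in\mathcal F_2$ and $$\vartheta:=\lim_{n\to\infty}\sqrt n\,\bigl(k(P_{t_n}\otimes Q_{t_n})-k(P_0\otimes Q_0)\bigr).$$ Then $$\lim_{n\to\infty}\int\psi_n\,dP_{t_n}^{n_1}\otimes Q_{t_n}^{n_2}=\Phi\Bigl(\frac\vartheta{\sigma_1}-u_{1-\frac\alpha2}\Bigr)+\Phi\Bigl(-\frac\vartheta{\sigma_1}-u_{1-\frac\alpha2}\Bigr).$$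
   Context: $\mathcal P,\mathcal Q$ are nonempty families of probability measures on $(\Omega_1,\mathcal A_1)$, $(\Omega_2,\mathcal A_2)$; $\mathcal P\otimes\mathcal Q=\{P\otimes Q:P\in\mathcal P,Q\in\mathcal Q\}$; $(\omega_{1,1},\dots,\omega_{1,n_1},\omega_{2,1},\dots,\omega_{2,n_2})$ is the generic point of $\Omega_1^{n_1}\times\Omega_2^{n_2}$. $\Phi$ is the standard normal distribution function and $u_{p}=\Phi^{-1}(p)$. $L_2^{(0)}(P)=\{h\in L_2(P):\int h\,dP=0\}$. With $dP/dQ$ the density quotient (a $[0,\infty]$-valued measurable $L$ with $P(A)=\int_AL\,dQ+P(A\cap\{L=\infty\})$, $Q(L<\infty)=1$), a curve $t\mapsto R_t$, $|t|<\varepsilon$, in a family $\mathcal R$ is $L_2(R_0)$-differentiable with tangent $g\in L_2(R_0)$ if $\|2((dR_t/dR_0)^{1/2}-1)-tg\|_{L_2(R_0)}=o(|t|)$ and $R_t(dR_t/dR_0=\infty)=o(t^2)$ as $t\to0$. A functional $k$ on $\mathcal R$ is differentiable at $R\in\mathcal R$ with gradient $\dot k\in L_2^{(0)}(R)$ if $\lim_{t\downarrow0}t^{-1}(k(R_t)-k(R))=\int\dot kg\,dR$ for each $L_2$-differentiable curve in $\mathcal R$ with $R_0=R$ and tangent $g$; the canonical gradient is the unique gradient in the tangent space $T(R,\mathcal R)$, the $L_2(R)$-closure of the linear span of all such tangents. At $P_0\otimes Q_0$ it decomposes uniquely as $\widetilde k(\omega_1,\omega_2)=\widetilde k_1(\omega_1)+\widetilde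 k_2(\omega_2)$ with $\widetilde k_1\in L_2^{(0)}(P_0)$, $\widetilde k_2\in L_2^{(0)}(Q_0)$. $\mathcal F_2$ is the set of all sequences $(P_{t_n}\otimes Q_{t_n})_n$ such that $t_n\to0$, $\lim_nt_n\sqrt n>0$, and there are $\varepsilon>0$ and an $L_2(P_0\otimes Q_0)$-differentiable curve $f:(-\varepsilon,\varepsilon)\to\mathcal P\otimes\mathcal Q$, $t\mapsto P_t\otimes Q_t$ (passing through $P_0\otimes Q_0$ at $t=0$) with $f(t_n)=P_{t_n}\otimes Q_{t_n}$ for all $n$. *)

theory Defs
  imports "HOL-Probability.Probability" "HOL-Library.Landau_Symbols"
begin

definition L2 :: "'a measure \<Rightarrow> ('a \<Rightarrow> real) set" where
  "L2 M = {h \<in> borel_measurable M. integrable M (\<lambda>x. (h x)\<^sup>2)}"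

definition L2_0 :: "'a measure \<Rightarrow> ('a \<Rightarrow> real) set" where
  "L2_0 M = {h \<in> L2 M. (\<integral>x. h x \<partial>M) = 0}"

text \<open>Only meaningful for \<open>h \<in> L2 M\<close>.\<close>
definition norm_L2 :: "'a measure \<Rightarrow> ('a \<Rightarrow> real) \<Rightarrow> real" where
  "norm_L2 M h = sqrt (\<integral>x. (h x)\<^sup>2 \<partial>M)"

text \<open>\<open>L\<close> is a version of the density quotient of \<open>P\<close> with respect to \<open>Q\<close>. For probability
  measures on the same measurable space a version always exists, and it is unique up to sets
  that are null for both \<open>P\<close> and \<open>Q\<close>.\<close>
definition is_density_quotient :: "'a measure \<Rightarrow> 'a measure \<Rightarrow> ('a \<Rightarrow> ennreal) \<Rightarrow> bool" where
  "is_density_quotient P Q L \<longleftrightarrow>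
     L \<in> borel_measurable Q \<and>
     (\<forall>A\<in>sets Q. emeasure P A =
        (\<integral>\<^sup>+x\<in>A. L x \<partial>Q) + emeasure P (A \<inter> {x \<in> space Q. L x = \<infinity>})) \<and>
     emeasure Q {x \<in> space Q. L x < \<infinity>} = 1"

text \<open>The curve is \<open>R\<close> restricted to \<open>{-\<epsilon><..<\<epsilon>}\<close>; values of \<open>R\<close> elsewhere are irrelevant. The
  two conditions do not depend on the versions \<open>L t\<close> that are chosen, and \<open>enn2real\<close> alters
  \<open>L t\<close> only on an \<open>R 0\<close>-null set.\<close>
definition L2_differentiable_curve ::
  "'a measure set \<Rightarrow> real \<Rightarrow> (real \<Rightarrow> 'a measure) \<Rightarrow> ('a \<Rightarrow> real) \<Rightarrow> bool" where
  "L2_differentiable_curve \<R> \<epsilon> R g \<longleftrightarrow>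
     \<epsilon> > 0 \<and> (\<forall>t. \<bar>t\<bar> < \<epsilon> \<longrightarrow> R t \<in> \<R>) \<and> g \<in> L2 (R 0) \<and>
     (\<exists>L. (\<forall>t. \<bar>t\<bar> < \<epsilon> \<longrightarrow> is_density_quotient (R t) (R 0) (L t)) \<and>
          (\<lambda>t. norm_L2 (R 0) (\<lambda>x. 2 * (sqrt (enn2real (L t x)) - 1) - t * g x))
             \<in> o[at 0](\<lambda>t. \<bar>t\<bar>) \<and>
          (\<lambda>t. measure (R t) {x \<in> space (R t). L t x = \<infinity>}) \<in> o[at 0](\<lambda>t. t\<^sup>2))"

definition tangents :: "'a measure \<Rightarrow> 'a measure set \<Rightarrow> ('a \<Rightarrow> real) set" where
  "tangents R\<^sub>0 \<R> = {g. \<exists>\<epsilon> R. L2_differentiable_curve \<R> \<epsilon> R g \<and> R 0 = R\<^sub>0}"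

definition lin_span :: "('a \<Rightarrow> real) set \<Rightarrow> ('a \<Rightarrow> real) set" where
  "lin_span S = {(\<lambda>x. \<Sum>g\<in>G. c g * g x) | G c. finite G \<and> G \<subseteq> S}"

definition L2_closure :: "'a measure \<Rightarrow> ('a \<Rightarrow> real) set \<Rightarrow> ('a \<Rightarrow> real) set" where
  "L2_closure M S = {h \<in> L2 M. \<forall>e>0. \<exists>g\<in>S. norm_L2 M (\<lambda>x. h x - g x) < e}"

definition tangent_space :: "'a measure \<Rightarrow> 'a measure set \<Rightarrow> ('a \<Rightarrow> real) set" where
  "tangent_space R\<^sub>0 \<R> = L2_closure R\<^sub>0 (lin_span (tangents R\<^sub>0 \<R>))"

definition is_gradient ::
  "('a measure \<Rightarrow> real) \<Rightarrow> 'a measure set \<Rightarrow> 'a measure \<Rightarrow> ('a \<Rightarrow> real) \<Rightarrow> bool" where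
  "is_gradient k \<R> R\<^sub>0 kd \<longleftrightarrow> kd \<in> L2_0 R\<^sub>0 \<and>
     (\<forall>\<epsilon> R g. L2_differentiable_curve \<R> \<epsilon> R g \<and> R 0 = R\<^sub>0 \<longrightarrow>
        ((\<lambda>t. (k (R t) - k R\<^sub>0) / t) \<longlongrightarrow> (\<integral>x. kd x * g x \<partial>R\<^sub>0)) (at_right 0))"

definition differentiable_functional ::
  "('a measure \<Rightarrow> real) \<Rightarrow> 'a measure set \<Rightarrow> 'a measure \<Rightarrow> bool" where
  "differentiable_functional k \<R> R\<^sub>0 \<longleftrightarrow> (\<exists>kd. is_gradient k \<R> R\<^sub>0 kd)"

definition is_canonical_gradient ::
  "('a measure \<Rightarrow> real) \<Rightarrow> 'a measure set \<Rightarrow> 'a measure \<Rightarrow> ('a \<Rightarrow> real) \<Rightarrow> bool" where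
  "is_canonical_gradient k \<R> R\<^sub>0 kt \<longleftrightarrow> is_gradient k \<R> R\<^sub>0 kt \<and> kt \<in> tangent_space R\<^sub>0 \<R>"

definition product_family ::
  "'a measure set \<Rightarrow> 'b measure set \<Rightarrow> ('a \<times> 'b) measure set" where
  "product_family \<P> \<Q> = {P \<Otimes>\<^sub>M Q | P Q. P \<in> \<P> \<and> Q \<in> \<Q>}"

definition F2 :: "'a measure set \<Rightarrow> 'b measure set \<Rightarrow> 'a measure \<Rightarrow> 'b measure
    \<Rightarrow> (nat \<Rightarrow> ('a \<times> 'b) measure) set" where
  "F2 \<P> \<Q> P\<^sub>0 Q\<^sub>0 = {S. \<exists>t. t \<longlonglongrightarrow> 0 \<and> (\<exists>c>0. (\<lambda>n. t n * sqrt (real n)) \<longlonglongrightarrow> c) \<and>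
     (\<exists>\<epsilon> f g. L2_differentiable_curve (product_family \<P> \<Q>) \<epsilon> f g \<and> f 0 = P\<^sub>0 \<Otimes>\<^sub>M Q\<^sub>0 \<and>
        (\<forall>n. \<bar>t n\<bar> < \<epsilon> \<and> S n = f (t n)))}"

definition \<Phi> :: "real \<Rightarrow> real" where
  "\<Phi> = cdf std_normal_distribution"

text \<open>\<open>\<Phi>\<close> is a bijection from the reals onto \<open>{0<..<1}\<close>, so this is the quantile for
  \<open>0 < p < 1\<close>.\<close>
definition normal_quantile :: "real \<Rightarrow> real" where
  "normal_quantile p = inv \<Phi> p"

definition sigma1 ::
  "real \<Rightarrow> 'a measure \<Rightarrow> 'b measure \<Rightarrow> ('a \<Rightarrow> real) \<Rightarrow> ('b \<Rightarrow> real) \<Rightarrow> real" where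
  "sigma1 d P\<^sub>0 Q\<^sub>0 k1 k2 =
     sqrt (1 / (1 - d) * (\<integral>x. (k1 x)\<^sup>2 \<partial>P\<^sub>0) + 1 / d * (\<integral>y. (k2 y)\<^sup>2 \<partial>Q\<^sub>0))"

text \<open>Here \<open>m1\<close> and \<open>m2\<close> are the two sample sizes; the total sample size is \<open>m1 + m2\<close>.\<close>
definition T_stat :: "nat \<Rightarrow> nat \<Rightarrow> ('a \<Rightarrow> real) \<Rightarrow> ('b \<Rightarrow> real)
    \<Rightarrow> (nat \<Rightarrow> 'a) \<times> (nat \<Rightarrow> 'b) \<Rightarrow> real" where
  "T_stat m1 m2 k1 k2 \<omega> =
     sqrt (real (m1 + m2)) / real m1 * (\<Sum>i=1..m1. k1 (fst \<omega> i)) +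
     sqrt (real (m1 + m2)) / real m2 * (\<Sum>j=1..m2. k2 (snd \<omega> j))"

definition psi :: "real \<Rightarrow> real \<Rightarrow> nat \<Rightarrow> nat \<Rightarrow> ('a \<Rightarrow> real) \<Rightarrow> ('b \<Rightarrow> real)
    \<Rightarrow> (nat \<Rightarrow> 'a) \<times> (nat \<Rightarrow> 'b) \<Rightarrow> real" where
  "psi \<alpha> \<sigma> m1 m2 k1 k2 \<omega> =
     (if \<bar>T_stat m1 m2 k1 k2 \<omega>\<bar> > normal_quantile (1 - \<alpha> / 2) * \<sigma> then 1 else 0)"

definition sample_measure ::
  "nat \<Rightarrow> nat \<Rightarrow> 'a measure \<Rightarrow> 'b measure \<Rightarrow> ((nat \<Rightarrow> 'a) \<times> (nat \<Rightarrow> 'b)) measure" where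
  "sample_measure m1 m2 P Q =
     (\<Pi>\<^sub>M i\<in>{1..m1}. P) \<Otimes>\<^sub>M (\<Pi>\<^sub>M j\<in>{1..m2}. Q)"

end

theory Submission
  imports Defs
begin

text \<open>
  Contiguity and Le Cam's third lemma are avoided by computing the limit of the characteristic
  function of \<open>T_n\<close> under the local alternatives themselves. By independence it is a product of two
  powers \<open>z\<^sup>m\<close>, where \<open>z\<close> integrates \<open>exp (\<i> a h)\<close>, \<open>a\<close> of order \<open>1 / sqrt n\<close>, against the
  distribution \<open>f t\<close> of a single pair of observations, so only the limit of \<open>m (z - 1)\<close> is needed.
  Differentiability of the curve says that the density of \<open>f t\<close> is \<open>(1 + (t g + r) / 2)\<^sup>2\<close> with
  \<open>r = o(t)\<close> in \<open>L2\<close>, up to a singular part of mass \<open>o(t\<^sup>2)\<close>. The term \<open>1\<close> contributes the usual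
  variance term of the central limit theorem, the term \<open>t g\<close> contributes the shift
  \<open>\<i> c \<integral>h g\<close>, and all remaining terms vanish in the limit. Levy's continuity theorem
  then gives asymptotic normality of \<open>T_n\<close> with mean \<open>\<theta>\<close> and variance \<open>\<sigma>\<^sup>2\<close>.
\<close>

subsection \<open>Density quotients and square integrable functions\<close>

lemma L2_integrable_mult:
  assumes "f \<in> L2 M" "g \<in> L2 M"
  shows "integrable M (\<lambda>x. f x * g x)"
proof (rule Bochner_Integration.integrable_bound)
  show "integrable M (\<lambda>x. (f x)\<^sup>2 + (g x)\<^sup>2)"
    using assms by (auto simp: L2_def)
  show "(\<lambda>x. f x * g x) \<in> borel_measurable M"
    using assms by (auto simp: L2_def)
  have "\<bar>a * b\<bar> \<le> \<bar>a\<^sup>2 + b\<^sup>2\<bar>" for a b :: real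
  proof -
    have "0 \<le> (\<bar>a\<bar> - \<bar>b\<bar>)\<^sup>2" by simp
    then have "2 * (\<bar>a\<bar> * \<bar>b\<bar>) \<le> a\<^sup>2 + b\<^sup>2" by (simp add: power2_diff)
    moreover have "0 \<le> \<bar>a\<bar> * \<bar>b\<bar>" by simp
    ultimately show ?thesis unfolding abs_mult by linarith
  qed
  then show "AE x in M. norm (f x * g x) \<le> norm ((f x)\<^sup>2 + (g x)\<^sup>2)"
    by simp
qed

lemma L2_Cauchy_Schwarz:
  assumes "f \<in> L2 M" "g \<in> L2 M"
  shows "(\<integral>x. \<bar>f x\<bar> * \<bar>g x\<bar> \<partial>M) \<le> norm_L2 M f * norm_L2 M g"
proof -
  have fm[measurable]: "f \<in> borel_measurable M" "g \<in> borel_measurable M"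
    using assms by (auto simp: L2_def)
  have int: "integrable M (\<lambda>x. \<bar>f x\<bar> * \<bar>g x\<bar>)"
    using integrable_abs[OF L2_integrable_mult[OF assms]] by (simp add: abs_mult)
  have intf: "integrable M (\<lambda>x. (f x)\<^sup>2)" "integrable M (\<lambda>x. (g x)\<^sup>2)"
    using assms by (auto simp: L2_def)
  have sq: "(ennreal \<bar>x\<bar>)\<^sup>2 = ennreal (x\<^sup>2)" for x :: real
    by (simp add: ennreal_power)
  have "(ennreal (\<integral>x. \<bar>f x\<bar> * \<bar>g x\<bar> \<partial>M))\<^sup>2 = (\<integral>\<^sup>+x. ennreal \<bar>f x\<bar> * ennreal \<bar>g x\<bar> \<partial>M)\<^sup>2"
    by (subst nn_integral_eq_integral[symmetric]) (use int in \<open>auto simp: ennreal_mult\<close>)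
  also have "\<dots> \<le> (\<integral>\<^sup>+x. (ennreal \<bar>f x\<bar>)\<^sup>2 \<partial>M) * (\<integral>\<^sup>+x. (ennreal \<bar>g x\<bar>)\<^sup>2 \<partial>M)"
    by (rule Cauchy_Schwarz_nn_integral) measurable
  also have "\<dots> = ennreal ((\<integral>x. (f x)\<^sup>2 \<partial>M) * (\<integral>x. (g x)\<^sup>2 \<partial>M))"
    unfolding sq using intf by (simp add: nn_integral_eq_integral ennreal_mult)
  finally have "(\<integral>x. \<bar>f x\<bar> * \<bar>g x\<bar> \<partial>M)\<^sup>2 \<le> (\<integral>x. (f x)\<^sup>2 \<partial>M) * (\<integral>x. (g x)\<^sup>2 \<partial>M)"
    by (simp add: ennreal_power)
  then show ?thesis
    unfolding norm_L2_def real_sqrt_mult[symmetric] by (rule real_le_rsqrt)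
qed

lemma integrable_bounded_mult:
  fixes \<phi> :: "'a \<Rightarrow> complex" and f :: "'a \<Rightarrow> real"
  assumes "integrable M f" "\<phi> \<in> borel_measurable M" "\<And>x. norm (\<phi> x) \<le> B"
  shows "integrable M (\<lambda>x. f x *\<^sub>R \<phi> x)"
proof (rule Bochner_Integration.integrable_bound)
  show "integrable M (\<lambda>x. B * \<bar>f x\<bar>)" using assms by simp
  show "(\<lambda>x. f x *\<^sub>R \<phi> x) \<in> borel_measurable M" using assms by measurable
  have "\<bar>f x\<bar> * norm (\<phi> x) \<le> \<bar>B\<bar> * \<bar>f x\<bar>" for x
    using mult_right_mono[OF order_trans[OF assms(3)[of x] abs_ge_self], of "\<bar>f x\<bar>"] by (simp add: mult.commute)
  then show "AE x in M. norm (f x *\<^sub>R \<phi> x) \<le> norm (B * \<bar>f x\<bar>)" by (simp add: abs_mult)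
qed

text \<open>On sets inside \<open>{L < \<infinity>}\<close> the singular term of the defining
  identity vanishes, so there \<open>L\<close> is an ordinary density. Since
  \<open>enn2real \<infinity> = 0\<close>, the right-hand side discards exactly the points that the
  indicator discards on the left.\<close>

lemma density_quotient_restrict:
  assumes L: "is_density_quotient S R L" and sets: "sets S = sets R"
    and R: "prob_space R" and S: "prob_space S"
  shows "density S (indicator {x \<in> space R. L x < \<infinity>}) = density R (\<lambda>x. ennreal (enn2real (L x)))"
proof (rule measure_eqI)
  have [measurable]: "L \<in> borel_measurable R" using L by (simp add: is_density_quotient_def)
  note [measurable_cong] = sets
  have sp: "space S = space R" using sets by (rule sets_eq_imp_space_eq)
  show "sets (density S (indicator {x \<in> space R. L x < \<infinity>})) = sets (density R (\<lambda>x. ennreal (enn2real (L x))))"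
    using sets by simp
  fix A assume "A \<in> sets (density S (indicator {x \<in> space R. L x < \<infinity>}))"
  then have [measurable]: "A \<in> sets R" using sets by simp
  let ?F = "{x \<in> space R. L x < \<infinity>}"
  have F[measurable]: "?F \<in> sets R" by measurable
  have "emeasure (density S (indicator ?F)) A = emeasure S (A \<inter> ?F)"
  proof -
    have "emeasure (density S (indicator ?F)) A = (\<integral>\<^sup>+x. indicator ?F x * indicator A x \<partial>S)"
      by (rule emeasure_density) measurable
    also have "\<dots> = (\<integral>\<^sup>+x. indicator (A \<inter> ?F) x \<partial>S)"
      by (rule nn_integral_cong) (simp split: split_indicator)
    finally show ?thesis by simp
  qed
  also have "\<dots> = (\<integral>\<^sup>+x\<in>A \<inter> ?F. L x \<partial>R) + emeasure S (A \<inter> ?F \<inter> {x \<in> space R. L x = \<infinity>})"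
    using L F \<open>A \<in> sets R\<close> unfolding is_density_quotient_def by blast
  also have "A \<inter> ?F \<inter> {x \<in> space R. L x = \<infinity>} = {}" by auto
  also have "(\<integral>\<^sup>+x\<in>A \<inter> ?F. L x \<partial>R) = (\<integral>\<^sup>+x. ennreal (enn2real (L x)) * indicator A x \<partial>R)"
  proof (rule nn_integral_cong)
    fix x assume "x \<in> space R"
    then show "L x * indicator (A \<inter> ?F) x = ennreal (enn2real (L x)) * indicator A x"
      by (cases "L x") (auto split: split_indicator)
  qed
  finally show "emeasure (density S (indicator ?F)) A = emeasure (density R (\<lambda>x. ennreal (enn2real (L x)))) A"
    by (simp add: emeasure_density)
qed

text \<open>By \<open>density_quotient_restrict\<close> the integral is the \<open>S\<close>-mass of
  a set, hence at most 1.\<close>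

lemma density_quotient_integrable:
  assumes "is_density_quotient S R L" "sets S = sets R" "prob_space R" "prob_space S"
  shows "integrable R (\<lambda>x. enn2real (L x))"
proof -
  have [measurable]: "L \<in> borel_measurable R" using assms by (simp add: is_density_quotient_def)
  note [measurable_cong] = assms(2)
  have F[measurable]: "{x \<in> space R. L x < \<infinity>} \<in> sets R" by measurable
  interpret S: prob_space S by fact
  have "(\<integral>\<^sup>+x. ennreal (enn2real (L x)) \<partial>R) = emeasure (density R (\<lambda>x. ennreal (enn2real (L x)))) (space R)"
    by (simp add: emeasure_density nn_integral_set_ennreal cong: nn_integral_cong)
  also have "\<dots> = emeasure (density S (indicator {x \<in> space R. L x < \<infinity>})) (space R)"
    by (simp only: density_quotient_restrict[OF assms])
  also have "\<dots> \<le> (\<integral>\<^sup>+x. 1 \<partial>S)"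
    using sets_eq_imp_space_eq[OF assms(2)]
    by (subst emeasure_density) (auto intro!: nn_integral_mono split: split_indicator simp: assms(2) simp del: nn_integral_const)
  also have "\<dots> = 1" by (simp add: S.emeasure_space_1)
  finally have "(\<integral>\<^sup>+x. ennreal (enn2real (L x)) \<partial>R) < \<infinity>"
    using order_le_less_trans by fastforce
  then show ?thesis
    by (intro integrableI_nonneg) auto
qed

text \<open>The difference is exactly the \<open>S\<close>-integral of \<phi> over the singular part
  \<open>{L = \<infinity>}\<close>, because on \<open>{L < \<infinity>}\<close> the density takes
  over.\<close>

lemma density_quotient_integral_approx:
  fixes \<phi> :: "'a \<Rightarrow> complex"
  assumes L: "is_density_quotient S R L" and sets: "sets S = sets R"
    and R: "prob_space R" and S: "prob_space S"
    and \<phi>[measurable]: "\<phi> \<in> borel_measurable R" and B: "\<And>x. norm (\<phi> x) \<le> B"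
  shows "norm ((\<integral>x. \<phi> x \<partial>S) - (\<integral>x. enn2real (L x) *\<^sub>R \<phi> x \<partial>R))
           \<le> B * measure S {x \<in> space S. L x = \<infinity>}"
proof -
  have [measurable]: "L \<in> borel_measurable R" using L by (simp add: is_density_quotient_def)
  note [measurable_cong] = sets
  interpret S: prob_space S by fact
  have sp: "space S = space R" using sets by (rule sets_eq_imp_space_eq)
  let ?F = "{x \<in> space R. L x < \<infinity>}" and ?I = "{x \<in> space S. L x = \<infinity>}"
  have [measurable]: "?F \<in> sets S" "?I \<in> sets S" by measurable
  have int: "integrable S \<phi>" by (intro S.integrable_const_bound[where B=B]) (auto simp: B)
  have intF: "integrable S (\<lambda>x. indicator ?F x *\<^sub>R \<phi> x)" 
    by (intro integrable_mult_indicator int) measurable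
  have intI: "integrable S (\<lambda>x. indicator ?I x *\<^sub>R \<phi> x)"
    by (intro integrable_mult_indicator int) measurable
  have "(\<integral>x. enn2real (L x) *\<^sub>R \<phi> x \<partial>R) = (\<integral>x. \<phi> x \<partial>density R (\<lambda>x. ennreal (enn2real (L x))))"
    by (rule integral_density[symmetric]) auto
  also have "\<dots> = (\<integral>x. \<phi> x \<partial>density S (\<lambda>x. ennreal (indicator ?F x)))"
    by (simp only: density_quotient_restrict[OF L sets R S, symmetric] ennreal_indicator)
  also have "\<dots> = (\<integral>x. indicator ?F x *\<^sub>R \<phi> x \<partial>S)"
    by (rule integral_density) auto
  finally have eq: "(\<integral>x. enn2real (L x) *\<^sub>R \<phi> x \<partial>R) = (\<integral>x. indicator ?F x *\<^sub>R \<phi> x \<partial>S)" .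
  have "(\<integral>x. \<phi> x \<partial>S) = (\<integral>x. indicator ?F x *\<^sub>R \<phi> x + indicator ?I x *\<^sub>R \<phi> x \<partial>S)"
  proof (rule Bochner_Integration.integral_cong)
    fix x assume "x \<in> space S"
    then show "\<phi> x = indicator ?F x *\<^sub>R \<phi> x + indicator ?I x *\<^sub>R \<phi> x"
      by (cases "L x") (auto simp: sp)
  qed simp
  also have "\<dots> = (\<integral>x. indicator ?F x *\<^sub>R \<phi> x \<partial>S) + (\<integral>x. indicator ?I x *\<^sub>R \<phi> x \<partial>S)"
    by (rule Bochner_Integration.integral_add[OF intF intI])
  finally have "norm ((\<integral>x. \<phi> x \<partial>S) - (\<integral>x. enn2real (L x) *\<^sub>R \<phi> x \<partial>R)) = norm (\<integral>x. indicator ?I x *\<^sub>R \<phi> x \<partial>S)"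
    unfolding eq by simp
  also have "\<dots> \<le> (\<integral>x. B * indicator ?I x \<partial>S)"
  proof (rule order_trans[OF integral_norm_bound integral_mono])
    show "integrable S (\<lambda>x. norm (indicator ?I x *\<^sub>R \<phi> x))" by (rule integrable_norm[OF intI])
    show "integrable S (\<lambda>x. B * indicat_real ?I x)"
      by (intro integrable_mult_right) (simp add: S.emeasure_eq_measure)
  qed (auto split: split_indicator simp: B)
  also have "\<dots> = B * measure S ?I"
    by simp
  finally show ?thesis .
qed

subsection \<open>Characteristic functions under a perturbed measure\<close>

lemma L2_cmult: "f \<in> L2 M \<Longrightarrow> (\<lambda>x. c * f x) \<in> L2 M"
  by (auto simp: L2_def power_mult_distrib)

lemma L2_add:
  assumes "f \<in> L2 M" "g \<in> L2 M"
  shows "(\<lambda>x. f x + g x) \<in> L2 M"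
  using assms L2_integrable_mult[OF assms]
  by (auto simp: L2_def power2_sum mult.assoc)

lemma (in prob_space) L2_const: "(\<lambda>x. c) \<in> L2 M"
  by (auto simp: L2_def)

lemma (in prob_space) L2_imp_integrable:
  assumes "f \<in> L2 M"
  shows "integrable M f"
  using L2_integrable_mult[OF assms L2_const[of 1]] by simp

text \<open>Here and in the next lemma the bound of lower order in \<open>x\<close> provides
  integrable majorants from second moments alone, while the bound of higher order makes the
  integrands vanish as the argument is scaled to 0.\<close>

lemma cmod_iexp_minus_one_le:
  "cmod (iexp x - 1) \<le> 2" "cmod (iexp x - 1) \<le> \<bar>x\<bar>"
  using iexp_approx2[of x 0] iexp_approx1[of x 0] by auto

lemma cmod_iexp_minus_linear_le:
  "cmod (iexp x - 1 - \<i> * x) \<le> 2 * \<bar>x\<bar>" "cmod (iexp x - 1 - \<i> * x) \<le> x\<^sup>2 / 2"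
  using iexp_approx2[of x 1] iexp_approx1[of x 1]
  by (auto simp: diff_diff_eq power2_eq_square simp flip: abs_mult)

text \<open>
  The five summands of the bound come from the terms \<open>1\<close>, \<open>\<tau> g\<close>, \<open>r\<close> and \<open>(\<tau> g + r)\<^sup>2 / 4\<close> of
  the expanded density and from the part of \<open>S\<close> that is singular to \<open>R\<close>.
\<close>
lemma char_perturbation_bound:
  fixes h g :: "'a \<Rightarrow> real" and a \<tau> :: real
  assumes L: "is_density_quotient S R L" and sets: "sets S = sets R"
    and R: "prob_space R" and S: "prob_space S"
    and h: "h \<in> L2_0 R" and g: "g \<in> L2 R"
  defines "r \<equiv> \<lambda>x. 2 * (sqrt (enn2real (L x)) - 1) - \<tau> * g x"
  shows "cmod ((\<integral>x. iexp (a * h x) - 1 \<partial>S)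
                - (\<i> * (a * \<tau> * (\<integral>x. h x * g x \<partial>R)) - a\<^sup>2 / 2 * (\<integral>x. (h x)\<^sup>2 \<partial>R)))
    \<le> a\<^sup>2 / 6 * (\<integral>x. min (6 * (h x)\<^sup>2) (\<bar>a\<bar> * \<bar>h x\<bar> ^ 3) \<partial>R)
      + \<bar>a\<bar> * \<bar>\<tau>\<bar> * (\<integral>x. \<bar>g x\<bar> * min (2 * \<bar>h x\<bar>) (\<bar>a\<bar> * (h x)\<^sup>2 / 2) \<partial>R)
      + \<bar>a\<bar> * (norm_L2 R h * norm_L2 R r)
      + (\<tau>\<^sup>2 / 2 * (\<integral>x. (g x)\<^sup>2 * min 2 (\<bar>a\<bar> * \<bar>h x\<bar>) \<partial>R) + (norm_L2 R r)\<^sup>2)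
      + 2 * measure S {x \<in> space S. L x = \<infinity>}"
proof -
  interpret R: prob_space R by fact
  interpret S: prob_space S by fact
  have hL: "h \<in> L2 R" and h0: "(\<integral>x. h x \<partial>R) = 0" using h by (auto simp: L2_0_def)
  have [measurable]: "h \<in> borel_measurable R" "g \<in> borel_measurable R" "L \<in> borel_measurable R"
    using hL g L by (auto simp: L2_def is_density_quotient_def)
  have inth: "integrable R h" "integrable R (\<lambda>x. (h x)\<^sup>2)"
    using R.L2_imp_integrable[OF hL] hL by (auto simp: L2_def)
  have intg: "integrable R g" "integrable R (\<lambda>x. (g x)\<^sup>2)"
    using R.L2_imp_integrable[OF g] g by (auto simp: L2_def)
  define l where "l x = enn2real (L x)" for x
  have [measurable]: "l \<in> borel_measurable R" unfolding l_def by measurable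
  have intl: "integrable R l"
    unfolding l_def by (rule density_quotient_integrable[OF L sets R S])
  have l_nonneg: "0 \<le> l x" for x by (simp add: l_def)
  \<comment> \<open>The square of this function is \<open>l\<close>, which is integrable;
    \<open>r\<close> is then a linear combination of members of \<open>L2 R\<close>.\<close>
  have "(\<lambda>x. sqrt (l x)) \<in> L2 R"
    using intl by (simp add: L2_def l_nonneg)
  then have "(\<lambda>x. (2 * sqrt (l x) + (-2)) + (-\<tau>) * g x) \<in> L2 R"
    by (intro L2_add L2_cmult R.L2_const g)
  then have rL: "r \<in> L2 R"
    by (simp add: r_def l_def algebra_simps)
  have [measurable]: "r \<in> borel_measurable R" using rL by (simp add: L2_def)
  have intr: "integrable R r" "integrable R (\<lambda>x. (r x)\<^sup>2)"
    using R.L2_imp_integrable[OF rL] rL by (auto simp: L2_def)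
  \<comment> \<open>By definition of \<open>r\<close>,
    \<open>sqrt (l x) = 1 + (\<tau> * g x + r x) / 2\<close>. Squaring turns the density into
    \<open>1 + \<tau> * g x + r x + q x\<close> (see \<open>l_eq\<close>), with \<open>q\<close> the
    quadratic part.\<close>
  define q where "q x = (\<tau> * g x + r x)\<^sup>2 / 4" for x
  have intq: "integrable R q"
    using L2_add[OF L2_cmult[OF g, of \<tau>] rL] by (simp add: q_def[abs_def] L2_def)
  have q_le: "0 \<le> q x" "q x \<le> \<tau>\<^sup>2 / 2 * (g x)\<^sup>2 + (r x)\<^sup>2 / 2" for x
  proof -
    show "0 \<le> q x" by (simp add: q_def)
    have "0 \<le> (\<tau> * g x - r x)\<^sup>2" by simp
    then show "q x \<le> \<tau>\<^sup>2 / 2 * (g x)\<^sup>2 + (r x)\<^sup>2 / 2"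
      by (simp add: q_def power2_eq_square algebra_simps)
  qed
  have l_eq: "l x = 1 + \<tau> * g x + r x + q x" for x
  proof -
    have e: "\<tau> * g x + r x = 2 * (sqrt (l x) - 1)" by (simp add: r_def l_def)
    have "\<tau> * g x + r x + q x = 2 * (sqrt (l x) - 1) + (sqrt (l x) - 1)\<^sup>2"
      unfolding q_def e power_mult_distrib by simp
    also have "\<dots> = l x - 1"
      using l_nonneg[of x] by (simp add: power2_diff)
    finally show ?thesis by simp
  qed
  define F where "F x = iexp (a * h x) - 1" for x
  have Fm[measurable]: "F \<in> borel_measurable R" unfolding F_def by measurable
  have F2: "cmod (F x) \<le> 2" and Fh: "cmod (F x) \<le> \<bar>a\<bar> * \<bar>h x\<bar>" for x
    using cmod_iexp_minus_one_le[of "a * h x"] by (simp_all add: F_def abs_mult)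
  note int = integrable_bounded_mult[OF _ Fm F2]
  have intF: "integrable R F"
    by (rule R.integrable_const_bound[where B=2]) (auto simp: F2)
  have intlin: "integrable R (\<lambda>x. g x *\<^sub>R (\<i> * (a * h x)))"
  proof -
    have "integrable R (\<lambda>x. (\<i> * a) * complex_of_real (g x * h x))"
      by (intro integrable_mult_right integrable_of_real L2_integrable_mult g hL)
    then show ?thesis by (simp add: scaleR_conv_of_real mult_ac)
  qed

  \<comment> \<open>Term \<open>1\<close> of the density. The right-hand side with its constants 6
    is the error of the second-order expansion \<open>char_approx3'\<close> for the centred variable
    \<open>h\<close>.\<close>
  have B0: "cmod ((\<integral>x. F x \<partial>R) + a\<^sup>2 / 2 * (\<integral>x. (h x)\<^sup>2 \<partial>R))
      \<le> a\<^sup>2 / 6 * (\<integral>x. min (6 * (h x)\<^sup>2) (\<bar>a\<bar> * \<bar>h x\<bar> ^ 3) \<partial>R)"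
  proof -
    have "char (distr R borel h) a = (\<integral>x. iexp (a * h x) \<partial>R)"
      by (simp add: char_def integral_distr)
    also have "\<dots> = (\<integral>x. F x \<partial>R) + 1"
      unfolding F_def by (subst Bochner_Integration.integral_diff)
        (auto intro!: R.integrable_iexp simp: R.prob_space)
    finally show ?thesis
      using R.char_approx3'[of h "\<integral>x. (h x)\<^sup>2 \<partial>R" "distr R borel h" a] inth h0
      by (simp add: algebra_simps)
  qed

  \<comment> \<open>Term \<open>\<tau> * g\<close> of the density. The linear Taylor term of
    \<open>F\<close> integrates to the shift; the Taylor remainder is controlled by the minimum of
    its two bounds.\<close>
  have Bg: "cmod ((\<integral>x. g x *\<^sub>R F x \<partial>R) - \<i> * (a * (\<integral>x. h x * g x \<partial>R)))
      \<le> \<bar>a\<bar> * (\<integral>x. \<bar>g x\<bar> * min (2 * \<bar>h x\<bar>) (\<bar>a\<bar> * (h x)\<^sup>2 / 2) \<partial>R)"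
  proof -
    have "(\<integral>x. g x *\<^sub>R (\<i> * (a * h x)) \<partial>R) = (\<integral>x. (\<i> * a) * of_real (h x * g x) \<partial>R)"
      by (rule Bochner_Integration.integral_cong) (simp_all add: scaleR_conv_of_real mult_ac)
    also have "\<dots> = \<i> * (a * (\<integral>x. h x * g x \<partial>R))"
      unfolding integral_mult_right_zero integral_complex_of_real by simp
    finally have lin: "(\<integral>x. g x *\<^sub>R (\<i> * (a * h x)) \<partial>R) = \<i> * (a * (\<integral>x. h x * g x \<partial>R))" .
    have "(\<integral>x. g x *\<^sub>R F x \<partial>R) - \<i> * (a * (\<integral>x. h x * g x \<partial>R))
        = (\<integral>x. g x *\<^sub>R F x - g x *\<^sub>R (\<i> * (a * h x)) \<partial>R)"
      unfolding lin[symmetric]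
      by (rule Bochner_Integration.integral_diff[symmetric, OF int intlin]) (simp_all add: intg)
    also have "cmod \<dots> \<le> (\<integral>x. \<bar>a\<bar> * (\<bar>g x\<bar> * min (2 * \<bar>h x\<bar>) (\<bar>a\<bar> * (h x)\<^sup>2 / 2)) \<partial>R)"
    proof (rule order_trans[OF integral_norm_bound integral_mono])
      show "integrable R (\<lambda>x. cmod (g x *\<^sub>R F x - g x *\<^sub>R (\<i> * (a * h x))))"
        using int[OF intg(1)] intlin by (intro integrable_norm Bochner_Integration.integrable_diff) simp_all
      have "integrable R (\<lambda>x. \<bar>g x\<bar> * min (2 * \<bar>h x\<bar>) (\<bar>a\<bar> * (h x)\<^sup>2 / 2))"
      proof (rule Bochner_Integration.integrable_bound)
        show "integrable R (\<lambda>x. 2 * (g x * h x))"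
          using L2_integrable_mult[OF g hL] by simp
        have "\<bar>g x\<bar> * \<bar>min (2 * \<bar>h x\<bar>) (\<bar>a\<bar> * (h x)\<^sup>2 / 2)\<bar> \<le> \<bar>g x\<bar> * (2 * \<bar>h x\<bar>)" for x
          by (rule mult_left_mono) (auto simp: min_def)
        then show "AE x in R. norm (\<bar>g x\<bar> * min (2 * \<bar>h x\<bar>) (\<bar>a\<bar> * (h x)\<^sup>2 / 2)) \<le> norm (2 * (g x * h x))"
          by (simp add: abs_mult mult_ac)
      qed (measurable)
      then show "integrable R (\<lambda>x. \<bar>a\<bar> * (\<bar>g x\<bar> * min (2 * \<bar>h x\<bar>) (\<bar>a\<bar> * (h x)\<^sup>2 / 2)))"
        by simp
      fix x
      have "cmod (F x - \<i> * (a * h x)) \<le> min (2 * \<bar>a * h x\<bar>) ((a * h x)\<^sup>2 / 2)"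
        using cmod_iexp_minus_linear_le[of "a * h x"] by (simp add: F_def)
      also have "\<dots> = \<bar>a\<bar> * min (2 * \<bar>h x\<bar>) (\<bar>a\<bar> * (h x)\<^sup>2 / 2)"
        unfolding mult_min_right[OF abs_ge_zero]
        by (rule arg_cong2[where f=min]) (simp_all add: abs_mult power2_eq_square)
      finally have "\<bar>g x\<bar> * cmod (F x - \<i> * (a * h x)) \<le> \<bar>g x\<bar> * (\<bar>a\<bar> * min (2 * \<bar>h x\<bar>) (\<bar>a\<bar> * (h x)\<^sup>2 / 2))"
        by (rule mult_left_mono) simp
      then show "cmod (g x *\<^sub>R F x - g x *\<^sub>R (\<i> * (a * h x))) \<le> \<bar>a\<bar> * (\<bar>g x\<bar> * min (2 * \<bar>h x\<bar>) (\<bar>a\<bar> * (h x)\<^sup>2 / 2))"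
        by (simp only: scaleR_diff_right[symmetric] norm_scaleR mult_ac)
    qed
    finally show ?thesis by simp
  qed

  \<comment> \<open>Term \<open>r\<close> of the density: \<open>F\<close> is at most
    \<open>\<bar>a\<bar> * \<bar>h x\<bar>\<close>, and Cauchy-Schwarz separates \<open>h\<close>
    from \<open>r\<close>.\<close>
  have Br: "cmod (\<integral>x. r x *\<^sub>R F x \<partial>R) \<le> \<bar>a\<bar> * (norm_L2 R h * norm_L2 R r)"
  proof -
    have "cmod (\<integral>x. r x *\<^sub>R F x \<partial>R) \<le> (\<integral>x. \<bar>a\<bar> * (\<bar>h x\<bar> * \<bar>r x\<bar>) \<partial>R)"
    proof (rule order_trans[OF integral_norm_bound integral_mono])
      show "integrable R (\<lambda>x. cmod (r x *\<^sub>R F x))"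
        by (rule integrable_norm, rule int) (simp_all add: intr)
      show "integrable R (\<lambda>x. \<bar>a\<bar> * (\<bar>h x\<bar> * \<bar>r x\<bar>))"
        using integrable_abs[OF L2_integrable_mult[OF hL rL]] by (simp add: abs_mult)
      show "cmod (r x *\<^sub>R F x) \<le> \<bar>a\<bar> * (\<bar>h x\<bar> * \<bar>r x\<bar>)" for x
        using mult_left_mono[OF Fh[of x], of "\<bar>r x\<bar>"] by (simp add: mult_ac)
    qed
    also have "\<dots> \<le> \<bar>a\<bar> * (norm_L2 R h * norm_L2 R r)"
      using L2_Cauchy_Schwarz[OF hL rL] by (simp add: mult_left_mono)
    finally show ?thesis .
  qed

  \<comment> \<open>Term \<open>q\<close> of the density. In the application
    \<open>\<tau>\<^sup>2\<close> is only of order \<open>1 / m\<close>, so the part with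
    \<open>g\<close> keeps a bound on \<open>F\<close> that vanishes with \<open>a\<close>. The part
    with \<open>r\<close> is already of smaller order, and the crude bound 2 on \<open>F\<close>
    suffices.\<close>
  have Bq: "cmod (\<integral>x. q x *\<^sub>R F x \<partial>R)
      \<le> \<tau>\<^sup>2 / 2 * (\<integral>x. (g x)\<^sup>2 * min 2 (\<bar>a\<bar> * \<bar>h x\<bar>) \<partial>R) + (norm_L2 R r)\<^sup>2"
  proof -
    have intm: "integrable R (\<lambda>x. (g x)\<^sup>2 * min 2 (\<bar>a\<bar> * \<bar>h x\<bar>))"
      by (rule Bochner_Integration.integrable_bound[OF integrable_mult_right[OF intg(2), of 2]])
         (auto simp: abs_mult mult.commute[of 2] intro!: AE_I2 mult_left_mono)
    have "cmod (\<integral>x. q x *\<^sub>R F x \<partial>R)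
        \<le> (\<integral>x. \<tau>\<^sup>2 / 2 * ((g x)\<^sup>2 * min 2 (\<bar>a\<bar> * \<bar>h x\<bar>)) + (r x)\<^sup>2 \<partial>R)"
    proof (rule order_trans[OF integral_norm_bound integral_mono])
      show "integrable R (\<lambda>x. cmod (q x *\<^sub>R F x))"
        by (rule integrable_norm, rule int) (simp_all add: intq)
      show "integrable R (\<lambda>x. \<tau>\<^sup>2 / 2 * ((g x)\<^sup>2 * min 2 (\<bar>a\<bar> * \<bar>h x\<bar>)) + (r x)\<^sup>2)"
        using intm intr by simp
      fix x
      have "cmod (q x *\<^sub>R F x) = q x * cmod (F x)" using q_le(1)[of x] by simp
      also have "\<dots> \<le> (\<tau>\<^sup>2 / 2 * (g x)\<^sup>2 + (r x)\<^sup>2 / 2) * cmod (F x)"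
        by (rule mult_right_mono[OF q_le(2)]) simp
      also have "\<dots> = \<tau>\<^sup>2 / 2 * (g x)\<^sup>2 * cmod (F x) + (r x)\<^sup>2 / 2 * cmod (F x)"
        by (simp add: algebra_simps)
      also have "\<dots> \<le> \<tau>\<^sup>2 / 2 * (g x)\<^sup>2 * min 2 (\<bar>a\<bar> * \<bar>h x\<bar>) + (r x)\<^sup>2 / 2 * 2"
        using F2[of x] Fh[of x] by (intro add_mono mult_left_mono) auto
      finally show "cmod (q x *\<^sub>R F x) \<le> \<tau>\<^sup>2 / 2 * ((g x)\<^sup>2 * min 2 (\<bar>a\<bar> * \<bar>h x\<bar>)) + (r x)\<^sup>2"
        by (simp add: mult_ac)
    qed
    also have "\<dots> = \<tau>\<^sup>2 / 2 * (\<integral>x. (g x)\<^sup>2 * min 2 (\<bar>a\<bar> * \<bar>h x\<bar>) \<partial>R) + (norm_L2 R r)\<^sup>2"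
      using intm intr by (simp add: norm_L2_def)
    finally show ?thesis .
  qed

  have BS: "cmod ((\<integral>x. F x \<partial>S) - (\<integral>x. l x *\<^sub>R F x \<partial>R)) \<le> 2 * measure S {x \<in> space S. L x = \<infinity>}"
    unfolding l_def by (rule density_quotient_integral_approx[OF L sets R S]) (simp_all add: F2)

  have "(\<integral>x. l x *\<^sub>R F x \<partial>R) = (\<integral>x. F x + \<tau> *\<^sub>R (g x *\<^sub>R F x) + r x *\<^sub>R F x + q x *\<^sub>R F x \<partial>R)"
    by (rule Bochner_Integration.integral_cong) (simp_all add: l_eq scaleR_add_left)
  also have "\<dots> = (\<integral>x. F x \<partial>R) + \<tau> *\<^sub>R (\<integral>x. g x *\<^sub>R F x \<partial>R) + (\<integral>x. r x *\<^sub>R F x \<partial>R) + (\<integral>x. q x *\<^sub>R F x \<partial>R)"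
    using intF int[OF intg(1)] int[OF intr(1)] int[OF intq] by (simp del: scaleR_scaleR)
  finally have split: "(\<integral>x. l x *\<^sub>R F x \<partial>R)
     = (\<integral>x. F x \<partial>R) + \<tau> *\<^sub>R (\<integral>x. g x *\<^sub>R F x \<partial>R) + (\<integral>x. r x *\<^sub>R F x \<partial>R) + (\<integral>x. q x *\<^sub>R F x \<partial>R)" .

  have Bg': "cmod (\<tau> *\<^sub>R ((\<integral>x. g x *\<^sub>R F x \<partial>R) - \<i> * (a * (\<integral>x. h x * g x \<partial>R))))
      \<le> \<bar>a\<bar> * \<bar>\<tau>\<bar> * (\<integral>x. \<bar>g x\<bar> * min (2 * \<bar>h x\<bar>) (\<bar>a\<bar> * (h x)\<^sup>2 / 2) \<partial>R)"
    using mult_left_mono[OF Bg, of "\<bar>\<tau>\<bar>"] by (simp only: norm_scaleR) (simp add: mult_ac)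
  have eq: "(\<integral>x. F x \<partial>S) - (\<i> * (a * \<tau> * (\<integral>x. h x * g x \<partial>R)) - a\<^sup>2 / 2 * (\<integral>x. (h x)\<^sup>2 \<partial>R))
    = ((\<integral>x. F x \<partial>R) + a\<^sup>2 / 2 * (\<integral>x. (h x)\<^sup>2 \<partial>R))
      + \<tau> *\<^sub>R ((\<integral>x. g x *\<^sub>R F x \<partial>R) - \<i> * (a * (\<integral>x. h x * g x \<partial>R)))
      + (\<integral>x. r x *\<^sub>R F x \<partial>R) + (\<integral>x. q x *\<^sub>R F x \<partial>R)
      + ((\<integral>x. F x \<partial>S) - (\<integral>x. l x *\<^sub>R F x \<partial>R))"
    unfolding split by (simp add: scaleR_conv_of_real algebra_simps)
  have "cmod ((\<integral>x. F x \<partial>S) - (\<i> * (a * \<tau> * (\<integral>x. h x * g x \<partial>R)) - a\<^sup>2 / 2 * (\<integral>x. (h x)\<^sup>2 \<partial>R)))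
      \<le> a\<^sup>2 / 6 * (\<integral>x. min (6 * (h x)\<^sup>2) (\<bar>a\<bar> * \<bar>h x\<bar> ^ 3) \<partial>R)
      + \<bar>a\<bar> * \<bar>\<tau>\<bar> * (\<integral>x. \<bar>g x\<bar> * min (2 * \<bar>h x\<bar>) (\<bar>a\<bar> * (h x)\<^sup>2 / 2) \<partial>R)
      + \<bar>a\<bar> * (norm_L2 R h * norm_L2 R r)
      + (\<tau>\<^sup>2 / 2 * (\<integral>x. (g x)\<^sup>2 * min 2 (\<bar>a\<bar> * \<bar>h x\<bar>) \<partial>R) + (norm_L2 R r)\<^sup>2)
      + 2 * measure S {x \<in> space S. L x = \<infinity>}"
    unfolding eq by (intro norm_triangle_mono B0 Bg' Br Bq BS)
  then show ?thesis unfolding F_def .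
qed

text \<open>Multiplied by \<open>m\<close>, the terms of \<open>char_perturbation_bound\<close>
  containing an integral over \<open>R\<close> of a minimum become a convergent factor times a null
  factor: \<open>I1\<close>, \<open>I2\<close>, \<open>I3\<close> vanish by dominated convergence.
  The terms from \<open>r\<close> and from the singular part vanish by \<open>mr\<close> and
  \<open>ms\<close>.\<close>

lemma char_perturbation_tendsto:
  fixes h g :: "'a \<Rightarrow> real" and a \<tau> m :: "nat \<Rightarrow> real"
  assumes L: "\<And>n. is_density_quotient (S n) R (L n)" and sets: "\<And>n. sets (S n) = sets R"
    and R: "prob_space R" and S: "\<And>n. prob_space (S n)"
    and h: "h \<in> L2_0 R" and g: "g \<in> L2 R" and m: "\<And>n. 0 \<le> m n"
    and a: "a \<longlonglongrightarrow> 0" and maa: "(\<lambda>n. m n * (a n)\<^sup>2) \<longlonglongrightarrow> \<kappa>"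
    and ma\<tau>: "(\<lambda>n. m n * a n * \<tau> n) \<longlonglongrightarrow> c" and m\<tau>\<tau>: "(\<lambda>n. m n * (\<tau> n)\<^sup>2) \<longlonglongrightarrow> b"
    and mr: "(\<lambda>n. m n * (norm_L2 R (\<lambda>x. 2 * (sqrt (enn2real (L n x)) - 1) - \<tau> n * g x))\<^sup>2) \<longlonglongrightarrow> 0"
    and ms: "(\<lambda>n. m n * measure (S n) {x \<in> space (S n). L n x = \<infinity>}) \<longlonglongrightarrow> 0"
  shows "(\<lambda>n. m n * (\<integral>x. iexp (a n * h x) - 1 \<partial>S n))
    \<longlonglongrightarrow> \<i> * (c * (\<integral>x. h x * g x \<partial>R)) - \<kappa> / 2 * (\<integral>x. (h x)\<^sup>2 \<partial>R)"
proof -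
  interpret R: prob_space R by fact
  have hL: "h \<in> L2 R" using h by (simp add: L2_0_def)
  have [measurable]: "h \<in> borel_measurable R" "g \<in> borel_measurable R"
    using hL g by (auto simp: L2_def)
  define r where "r n = norm_L2 R (\<lambda>x. 2 * (sqrt (enn2real (L n x)) - 1) - \<tau> n * g x)" for n
  define s where "s n = measure (S n) {x \<in> space (S n). L n x = \<infinity>}" for n
  define I1 where "I1 n = (\<integral>x. min (6 * (h x)\<^sup>2) (\<bar>a n\<bar> * \<bar>h x\<bar> ^ 3) \<partial>R)" for n
  define I2 where "I2 n = (\<integral>x. \<bar>g x\<bar> * min (2 * \<bar>h x\<bar>) (\<bar>a n\<bar> * (h x)\<^sup>2 / 2) \<partial>R)" for n
  define I3 where "I3 n = (\<integral>x. (g x)\<^sup>2 * min 2 (\<bar>a n\<bar> * \<bar>h x\<bar>) \<partial>R)" for n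
  have aabs: "(\<lambda>n. \<bar>a n\<bar>) \<longlonglongrightarrow> 0" using tendsto_rabs[OF a] by simp
  have a_mult: "(\<lambda>n. \<bar>a n\<bar> * y) \<longlonglongrightarrow> 0" for y :: real
    using tendsto_mult_right[OF aabs, of y] by simp
  have min0: "(\<lambda>n. min x (\<bar>a n\<bar> * y)) \<longlonglongrightarrow> 0" if "0 \<le> x" for x y :: real
    using tendsto_min[OF tendsto_const[of x] a_mult[of y]] that by (simp add: min_absorb2)

  have "I1 \<longlonglongrightarrow> (\<integral>x. 0 \<partial>R)"
    unfolding I1_def
  proof (rule integral_dominated_convergence[where w="\<lambda>x. 6 * (h x)\<^sup>2"])
    show "integrable R (\<lambda>x. 6 * (h x)\<^sup>2)" using hL by (simp add: L2_def)
    show "AE x in R. (\<lambda>n. min (6 * (h x)\<^sup>2) (\<bar>a n\<bar> * \<bar>h x\<bar> ^ 3)) \<longlonglongrightarrow> 0"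
      by (intro AE_I2 min0) simp
    show "AE x in R. norm (min (6 * (h x)\<^sup>2) (\<bar>a n\<bar> * \<bar>h x\<bar> ^ 3)) \<le> 6 * (h x)\<^sup>2" for n
      by (intro AE_I2) (auto simp: min_def)
  qed measurable
  then have I1: "I1 \<longlonglongrightarrow> 0" by simp

  have "I2 \<longlonglongrightarrow> (\<integral>x. 0 \<partial>R)"
    unfolding I2_def
  proof (rule integral_dominated_convergence[where w="\<lambda>x. 2 * \<bar>g x * h x\<bar>"])
    show "integrable R (\<lambda>x. 2 * \<bar>g x * h x\<bar>)"
      by (intro integrable_mult_right integrable_abs L2_integrable_mult g hL)
    show "AE x in R. (\<lambda>n. \<bar>g x\<bar> * min (2 * \<bar>h x\<bar>) (\<bar>a n\<bar> * (h x)\<^sup>2 / 2)) \<longlonglongrightarrow> 0"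
    proof (rule AE_I2)
      fix x
      show "(\<lambda>n. \<bar>g x\<bar> * min (2 * \<bar>h x\<bar>) (\<bar>a n\<bar> * (h x)\<^sup>2 / 2)) \<longlonglongrightarrow> 0"
        using tendsto_mult_left[OF min0[of "2 * \<bar>h x\<bar>" "(h x)\<^sup>2 / 2"], of "\<bar>g x\<bar>"] by simp
    qed
    have "\<bar>g x\<bar> * \<bar>min (2 * \<bar>h x\<bar>) (\<bar>a n\<bar> * (h x)\<^sup>2 / 2)\<bar> \<le> \<bar>g x\<bar> * (2 * \<bar>h x\<bar>)" for n x
      by (rule mult_left_mono) (auto simp: min_def)
    then show "AE x in R. norm (\<bar>g x\<bar> * min (2 * \<bar>h x\<bar>) (\<bar>a n\<bar> * (h x)\<^sup>2 / 2)) \<le> 2 * \<bar>g x * h x\<bar>" for n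
      by (simp add: abs_mult mult_ac)
  qed measurable
  then have I2: "I2 \<longlonglongrightarrow> 0" by simp

  have "I3 \<longlonglongrightarrow> (\<integral>x. 0 \<partial>R)"
    unfolding I3_def
  proof (rule integral_dominated_convergence[where w="\<lambda>x. 2 * (g x)\<^sup>2"])
    show "integrable R (\<lambda>x. 2 * (g x)\<^sup>2)" using g by (simp add: L2_def)
    show "AE x in R. (\<lambda>n. (g x)\<^sup>2 * min 2 (\<bar>a n\<bar> * \<bar>h x\<bar>)) \<longlonglongrightarrow> 0"
    proof (rule AE_I2)
      fix x
      show "(\<lambda>n. (g x)\<^sup>2 * min 2 (\<bar>a n\<bar> * \<bar>h x\<bar>)) \<longlonglongrightarrow> 0"
        using tendsto_mult_left[OF min0[of 2 "\<bar>h x\<bar>"], of "(g x)\<^sup>2"] by simp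
    qed
    have "(g x)\<^sup>2 * \<bar>min 2 (\<bar>a n\<bar> * \<bar>h x\<bar>)\<bar> \<le> (g x)\<^sup>2 * 2" for n x
      by (rule mult_left_mono) (auto simp: min_def)
    then show "AE x in R. norm ((g x)\<^sup>2 * min 2 (\<bar>a n\<bar> * \<bar>h x\<bar>)) \<le> 2 * (g x)\<^sup>2" for n
      by (simp add: abs_mult mult_ac)
  qed measurable
  then have I3: "I3 \<longlonglongrightarrow> 0" by simp

  define X where "X n = (\<integral>x. iexp (a n * h x) - 1 \<partial>S n)" for n
  define Y where "Y n = \<i> * (a n * \<tau> n * (\<integral>x. h x * g x \<partial>R)) - (a n)\<^sup>2 / 2 * (\<integral>x. (h x)\<^sup>2 \<partial>R)" for n
  define B where "B n = (a n)\<^sup>2 / 6 * I1 n + \<bar>a n\<bar> * \<bar>\<tau> n\<bar> * I2 n + \<bar>a n\<bar> * (norm_L2 R h * r n)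
      + ((\<tau> n)\<^sup>2 / 2 * I3 n + (r n)\<^sup>2) + 2 * s n" for n
  have XY: "cmod (X n - Y n) \<le> B n" for n
    using char_perturbation_bound[OF L sets R S h g, of n "a n" "\<tau> n"]
    by (simp add: X_def Y_def B_def I1_def I2_def I3_def r_def s_def)
  have r_nonneg: "0 \<le> r n" for n
    unfolding r_def norm_L2_def by simp
  \<comment> \<open>The factor \<open>m\<close> is distributed so that only the quantities
    controlled by the hypotheses appear. In the mixed term it is split as
    \<open>sqrt m * sqrt m\<close> between \<open>a\<close> and \<open>r\<close>.\<close>
  have mB: "m n * B n = (m n * (a n)\<^sup>2) / 6 * I1 n + \<bar>m n * a n * \<tau> n\<bar> * I2 n
      + norm_L2 R h * (sqrt (m n * (a n)\<^sup>2) * sqrt (m n * (r n)\<^sup>2))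
      + ((m n * (\<tau> n)\<^sup>2) / 2 * I3 n + m n * (r n)\<^sup>2) + 2 * (m n * s n)" for n
  proof -
    have "sqrt (m n * (a n)\<^sup>2) * sqrt (m n * (r n)\<^sup>2) = (sqrt (m n) * sqrt (m n)) * \<bar>a n\<bar> * r n"
      using m[of n] r_nonneg[of n] by (simp add: real_sqrt_mult)
    also have "\<dots> = m n * \<bar>a n\<bar> * r n" using m[of n] by simp
    finally show ?thesis
      using m[of n] by (simp add: B_def abs_mult algebra_simps)
  qed
  have "(\<lambda>n. m n * B n) \<longlonglongrightarrow> \<kappa> / 6 * 0 + \<bar>c\<bar> * 0 + norm_L2 R h * (sqrt \<kappa> * sqrt 0) + (b / 2 * 0 + 0) + 2 * 0"
    unfolding mB by (intro tendsto_intros maa ma\<tau> m\<tau>\<tau> I1 I2 I3 mr[folded r_def] ms[folded s_def]) simp_all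
  then have "(\<lambda>n. m n * B n) \<longlonglongrightarrow> 0" by simp
  then have 1: "(\<lambda>n. m n * (X n - Y n)) \<longlonglongrightarrow> 0"
  proof (rule Lim_null_comparison[rotated])
    show "\<forall>\<^sub>F n in sequentially. cmod (m n * (X n - Y n)) \<le> m n * B n"
      using XY m by (intro always_eventually) (simp add: norm_mult mult_left_mono)
  qed
  have mY: "m n * Y n = \<i> * ((m n * a n * \<tau> n) * (\<integral>x. h x * g x \<partial>R)) - (m n * (a n)\<^sup>2) / 2 * (\<integral>x. (h x)\<^sup>2 \<partial>R)" for n
    by (simp add: Y_def algebra_simps)
  have 2: "(\<lambda>n. m n * Y n) \<longlonglongrightarrow> \<i> * (c * (\<integral>x. h x * g x \<partial>R)) - \<kappa> / 2 * (\<integral>x. (h x)\<^sup>2 \<partial>R)"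
    unfolding mY of_real_mult[symmetric] of_real_divide[symmetric]
    by (intro tendsto_intros tendsto_of_real ma\<tau> maa) simp_all
  show ?thesis
    using tendsto_add[OF 1 2] by (simp add: X_def algebra_simps)
qed

text \<open>\<open>z ^ m\<close> is compared with \<open>exp (w / m) ^ m\<close>, which equals
  \<open>exp w\<close>. Both bases lie in the closed unit disc, the second because
  \<open>Re w \<le> 0\<close>, so the powers differ by at most \<open>m\<close> times the difference
  of the bases. That tends to 0 since \<open>m * (z - 1)\<close> and
  \<open>m * (exp (w / m) - 1)\<close> have the common limit \<open>w\<close>.\<close>

lemma power_tendsto_exp:
  fixes z :: "nat \<Rightarrow> complex" and m :: "nat \<Rightarrow> nat"
  assumes z: "\<And>n. cmod (z n) \<le> 1" and w: "Re w \<le> 0"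
    and m: "filterlim m at_top sequentially"
    and lim: "(\<lambda>n. m n * (z n - 1)) \<longlonglongrightarrow> w"
  shows "(\<lambda>n. z n ^ m n) \<longlonglongrightarrow> exp w"
proof -
  have pos: "\<forall>\<^sub>F n in sequentially. 0 < m n"
    using m[unfolded filterlim_at_top, rule_format, of 1] by (rule eventually_mono) simp
  have rm: "filterlim (\<lambda>n. complex_of_real (inverse (real (m n)))) (at 0) sequentially"
    unfolding filterlim_at
  proof
    show "\<forall>\<^sub>F n in sequentially. complex_of_real (inverse (real (m n))) \<in> UNIV \<and> complex_of_real (inverse (real (m n))) \<noteq> 0"
      using pos by (rule eventually_mono) simp
    have "(\<lambda>n. inverse (real (m n))) \<longlonglongrightarrow> 0"
      by (rule tendsto_inverse_0_at_top[OF filterlim_compose[OF filterlim_real_sequentially m]])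
    then have "(\<lambda>n. complex_of_real (inverse (real (m n)))) \<longlonglongrightarrow> complex_of_real 0"
      by (rule tendsto_of_real)
    then show "(\<lambda>n. complex_of_real (inverse (real (m n)))) \<longlonglongrightarrow> 0"
      by (simp only: of_real_0)
  qed
  \<comment> \<open>The limit \<open>E\<close> is this derivative at 0, evaluated along the points
    \<open>1 / m n\<close>.\<close>
  have "((\<lambda>x. exp (w * x)) has_field_derivative w) (at 0)"
    by (auto intro!: derivative_eq_intros)
  then have "((\<lambda>x. (exp (w * x) - 1) / x) \<longlongrightarrow> w) (at 0)"
    by (simp add: has_field_derivative_iff)
  from filterlim_compose[OF this rm]
  have E: "(\<lambda>n. m n * (exp (w / m n) - 1)) \<longlonglongrightarrow> w"
    by (simp add: field_simps)
  have "(\<lambda>n. cmod (m n * (z n - 1) - m n * (exp (w / m n) - 1))) \<longlonglongrightarrow> 0"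
    using tendsto_diff[OF lim E] by (simp add: tendsto_norm_zero_iff)
  then have "(\<lambda>n. z n ^ m n - exp (w / m n) ^ m n) \<longlonglongrightarrow> 0"
  proof (rule Lim_null_comparison[rotated])
    have "cmod (z n ^ m n - exp (w / m n) ^ m n) \<le> cmod (m n * (z n - 1) - m n * (exp (w / m n) - 1))" for n
    proof -
      have "cmod (exp (w / m n)) \<le> 1"
        using w by (simp add: divide_nonpos_nonneg)
      then have "cmod (z n ^ m n - exp (w / m n) ^ m n) \<le> m n * cmod (z n - exp (w / m n))"
        by (intro norm_power_diff z)
      also have "\<dots> = cmod (m n * (z n - exp (w / m n)))"
        by (simp add: norm_mult)
      finally show ?thesis by (simp add: algebra_simps)
    qed
    then show "\<forall>\<^sub>F n in sequentially. cmod (z n ^ m n - exp (w / m n) ^ m n) \<le> cmod (m n * (z n - 1) - m n * (exp (w / m n) - 1))"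
      by simp
  qed
  \<comment> \<open>Only eventually: where \<open>m n = 0\<close> the power is 1 whatever
    \<open>w\<close> is.\<close>
  moreover have "\<forall>\<^sub>F n in sequentially. exp (w / m n) ^ m n = exp w"
    using pos by eventually_elim (simp add: exp_of_nat_mult[symmetric])
  then have "(\<lambda>n. exp (w / m n) ^ m n) \<longlonglongrightarrow> exp w"
    by (rule tendsto_eventually)
  ultimately show ?thesis
    using tendsto_add by fastforce
qed

section \<open>Factorization of integrals over a product measure\<close>

lemma integral_pair_mult:
  fixes f :: "'a \<Rightarrow> complex" and g :: "'b \<Rightarrow> complex"
  assumes "prob_space M" "prob_space N"
    and [measurable]: "f \<in> borel_measurable M" "g \<in> borel_measurable N"
    and f: "\<And>x. cmod (f x) \<le> 1" and g: "\<And>x. cmod (g x) \<le> 1"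
  shows "(\<integral>\<omega>. f (fst \<omega>) * g (snd \<omega>) \<partial>(M \<Otimes>\<^sub>M N)) = (\<integral>x. f x \<partial>M) * (\<integral>y. g y \<partial>N)"
proof -
  interpret M: prob_space M by fact
  interpret N: prob_space N by fact
  interpret pair_prob_space M N ..
  have "integrable (M \<Otimes>\<^sub>M N) (\<lambda>\<omega>. f (fst \<omega>) * g (snd \<omega>))"
    by (rule P.integrable_const_bound[where B=1]) (auto simp: norm_mult intro!: mult_le_one f g)
  from integral_fst'[OF this] show ?thesis by simp
qed

subsection \<open>The two-sample statistic\<close>

lemma prob_space_sample_measure:
  assumes "prob_space P" "prob_space Q"
  shows "prob_space (sample_measure m1 m2 P Q)"
proof -
  interpret A: prob_space "\<Pi>\<^sub>M i\<in>{1..m1}. P" using assms by (intro prob_space_PiM)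
  interpret B: prob_space "\<Pi>\<^sub>M i\<in>{1..m2}. Q" using assms by (intro prob_space_PiM)
  interpret pair_prob_space "\<Pi>\<^sub>M i\<in>{1..m1}. P" "\<Pi>\<^sub>M i\<in>{1..m2}. Q" ..
  show ?thesis unfolding sample_measure_def by (rule P.prob_space_axioms)
qed

lemma T_stat_measurable:
  assumes [measurable]: "k1 \<in> borel_measurable P" "k2 \<in> borel_measurable Q"
  shows "T_stat m1 m2 k1 k2 \<in> borel_measurable (sample_measure m1 m2 P Q)"
  unfolding T_stat_def[abs_def] sample_measure_def by measurable

text \<open>The exponential turns the two sums in \<open>T_stat\<close> into products over all
  coordinates, which are integrated factor by factor by independence. Empty samples are covered:
  their sum is 0 and the corresponding power is 1.\<close>

lemma char_T_stat:
  fixes k1 :: "'a \<Rightarrow> real" and k2 :: "'b \<Rightarrow> real"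
  assumes P: "prob_space P" and Q: "prob_space Q"
    and [measurable]: "k1 \<in> borel_measurable P" "k2 \<in> borel_measurable Q"
  shows "(\<integral>\<omega>. iexp (s * T_stat m1 m2 k1 k2 \<omega>) \<partial>sample_measure m1 m2 P Q)
    = (\<integral>x. iexp (s * (sqrt (real (m1 + m2)) / m1) * k1 x) \<partial>P) ^ m1
      * (\<integral>y. iexp (s * (sqrt (real (m1 + m2)) / m2) * k2 y) \<partial>Q) ^ m2"
proof -
  interpret P: prob_space P by fact
  interpret Q: prob_space Q by fact
  interpret PP: product_sigma_finite "\<lambda>_. P" ..
  interpret QQ: product_sigma_finite "\<lambda>_. Q" ..
  define f where "f x = iexp (s * (sqrt (real (m1 + m2)) / m1) * k1 x)" for x
  define g where "g y = iexp (s * (sqrt (real (m1 + m2)) / m2) * k2 y)" for y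
  have [measurable]: "f \<in> borel_measurable P" "g \<in> borel_measurable Q"
    unfolding f_def g_def by measurable
  have eq: "iexp (s * T_stat m1 m2 k1 k2 \<omega>) = (\<Prod>i\<in>{1..m1}. f (fst \<omega> i)) * (\<Prod>j\<in>{1..m2}. g (snd \<omega> j))" for \<omega>
    by (simp add: f_def g_def exp_sum[symmetric] exp_add[symmetric] T_stat_def sum_distrib_left
      algebra_simps)
  have n: "cmod (\<Prod>i\<in>{1..m1}. f (x i)) \<le> 1" "cmod (\<Prod>j\<in>{1..m2}. g (y j)) \<le> 1" for x y
    by (simp_all add: f_def g_def prod_norm[symmetric])
  have i: "integrable P f" "integrable Q g"
    by (auto intro!: P.integrable_const_bound[where B=1] Q.integrable_const_bound[where B=1] simp: f_def g_def)
  have "(\<integral>\<omega>. iexp (s * T_stat m1 m2 k1 k2 \<omega>) \<partial>sample_measure m1 m2 P Q)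
    = (\<integral>x. (\<Prod>i\<in>{1..m1}. f (x i)) \<partial>(\<Pi>\<^sub>M i\<in>{1..m1}. P)) * (\<integral>y. (\<Prod>j\<in>{1..m2}. g (y j)) \<partial>(\<Pi>\<^sub>M j\<in>{1..m2}. Q))"
    unfolding eq sample_measure_def
  proof (rule integral_pair_mult[where f="\<lambda>x. \<Prod>i\<in>{1..m1}. f (x i)" and g="\<lambda>y. \<Prod>j\<in>{1..m2}. g (y j)"])
    show "prob_space (\<Pi>\<^sub>M i\<in>{1..m1}. P)" "prob_space (\<Pi>\<^sub>M j\<in>{1..m2}. Q)"
      by (simp_all add: prob_space_PiM P Q)
    show "(\<lambda>x. \<Prod>i\<in>{1..m1}. f (x i)) \<in> borel_measurable (\<Pi>\<^sub>M i\<in>{1..m1}. P)"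
      "(\<lambda>y. \<Prod>j\<in>{1..m2}. g (y j)) \<in> borel_measurable (\<Pi>\<^sub>M j\<in>{1..m2}. Q)"
      by measurable
  qed (rule n)+
  also have "(\<integral>x. (\<Prod>i\<in>{1..m1}. f (x i)) \<partial>(\<Pi>\<^sub>M i\<in>{1..m1}. P)) = (\<Prod>i\<in>{1..m1}. \<integral>x. f x \<partial>P)"
    by (rule PP.product_integral_prod) (simp_all add: i)
  also have "(\<integral>y. (\<Prod>j\<in>{1..m2}. g (y j)) \<partial>(\<Pi>\<^sub>M j\<in>{1..m2}. Q)) = (\<Prod>j\<in>{1..m2}. \<integral>y. g y \<partial>Q)"
    by (rule QQ.product_integral_prod) (simp_all add: i)
  finally show ?thesis by (simp add: f_def g_def)
qed

subsection \<open>The standard normal distribution\<close>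

interpretation std_normal: real_distribution std_normal_distribution
  by (rule real_dist_normal_dist)

lemma std_normal_singleton: "emeasure std_normal_distribution {x} = 0"
proof -
  have "emeasure std_normal_distribution {x} = (\<integral>\<^sup>+y\<in>{x}. ennreal (std_normal_density y) \<partial>lborel)"
    by (rule emeasure_density) auto
  also have "\<dots> = 0"
    by (rule nn_integral_null_set) auto
  finally show ?thesis .
qed

lemma std_normal_lessThan: "measure std_normal_distribution {..<x} = \<Phi> x"
proof -
  have "\<Phi> x = measure std_normal_distribution ({..<x} \<union> {x})"
    unfolding \<Phi>_def cdf_def by (rule arg_cong[where f="measure _"]) auto
  also have "\<dots> = measure std_normal_distribution {..<x} + measure std_normal_distribution {x}"
    by (rule std_normal.finite_measure_Union) auto
  also have "measure std_normal_distribution {x} = 0"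
    by (simp add: measure_def std_normal_singleton)
  finally show ?thesis by simp
qed

text \<open>Symmetry is read off the characteristic function, which is even and determines the
  law.\<close>

lemma std_normal_reflect: "distr std_normal_distribution borel uminus = std_normal_distribution"
proof (rule Levy_uniqueness)
  show "real_distribution (distr std_normal_distribution borel uminus)"
    by (rule std_normal.real_distribution_distr) simp
  show "char (distr std_normal_distribution borel uminus) = char std_normal_distribution"
  proof
    fix t
    have "char (distr std_normal_distribution borel uminus) t = char std_normal_distribution (- t)"
      unfolding char_def by (subst integral_distr) auto
    then show "char (distr std_normal_distribution borel uminus) t = char std_normal_distribution t"
      by (simp add: char_std_normal_distribution)
  qed
qed (rule real_dist_normal_dist)

lemma std_normal_greaterThan: "measure std_normal_distribution {x<..} = \<Phi> (- x)"
proof -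
  have "measure std_normal_distribution {x<..} = measure (distr std_normal_distribution borel uminus) {x<..}"
    by (simp only: std_normal_reflect)
  also have "\<dots> = measure std_normal_distribution {..<-x}"
    by (subst measure_distr) (auto intro!: arg_cong[where f="measure _"])
  finally show ?thesis by (simp add: std_normal_lessThan)
qed

lemma \<Phi>_uminus: "\<Phi> (- x) = 1 - \<Phi> x"
proof -
  have "\<Phi> (- x) = measure std_normal_distribution (space std_normal_distribution - {..x})"
    unfolding std_normal_greaterThan[symmetric] by (rule arg_cong[where f="measure _"]) auto
  also have "\<dots> = 1 - measure std_normal_distribution {..x}"
    by (rule std_normal.prob_compl) simp
  finally show ?thesis by (simp add: \<Phi>_def cdf_def)
qed

lemma \<Phi>_mono: "x \<le> y \<Longrightarrow> \<Phi> x \<le> \<Phi> y"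
  unfolding \<Phi>_def by (rule std_normal.cdf_nondecreasing)

text \<open>As \<open>inv\<close> merely selects a preimage, the content is that \<open>p\<close>
  lies in the range of \<Phi>. This is the intermediate value theorem: \<Phi> is continuous because
  the normal law has no atoms, and its limits are 0 and 1.\<close>

lemma \<Phi>_normal_quantile:
  assumes "0 < p" "p < 1"
  shows "\<Phi> (normal_quantile p) = p"
proof -
  have "eventually (\<lambda>x. \<Phi> x < p) at_bot"
    unfolding \<Phi>_def using std_normal.cdf_lim_at_bot assms(1) by (rule order_tendstoD(2))
  then obtain a where a: "\<Phi> a < p" by (auto dest: eventually_happens)
  have "eventually (\<lambda>x. p < \<Phi> x) at_top"
    unfolding \<Phi>_def using std_normal.cdf_lim_at_top_prob assms(2) by (rule order_tendstoD(1))
  then obtain b where b: "p < \<Phi> b" by (auto dest: eventually_happens)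
  have "a \<le> b" using a b \<Phi>_mono[of b a] by linarith
  moreover have "isCont \<Phi> x" for x
    unfolding \<Phi>_def by (simp add: std_normal.isCont_cdf measure_def std_normal_singleton)
  ultimately have "\<exists>x\<ge>a. x \<le> b \<and> \<Phi> x = p"
    using a b by (intro IVT) auto
  then have "p \<in> range \<Phi>" by auto
  then show ?thesis unfolding normal_quantile_def by (rule f_inv_into_f)
qed

text \<open>Makes the two tails of the rejection region disjoint, so that their probabilities add in
  \<open>two_sided_tail_tendsto\<close>.\<close>

lemma normal_quantile_nonneg:
  assumes "1 / 2 < p" "p < 1"
  shows "0 \<le> normal_quantile p"
proof (rule ccontr)
  assume "\<not> ?thesis"
  then have "\<Phi> (normal_quantile p) \<le> \<Phi> 0" by (intro \<Phi>_mono) simp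
  moreover have "\<Phi> 0 = 1 / 2" using \<Phi>_uminus[of 0] by simp
  ultimately show False using \<Phi>_normal_quantile[of p] assms by simp
qed

text \<open>After standardization Levy's theorem gives weak convergence of the laws to the standard
  normal; the underlying spaces \<open>M n\<close> may vary with \<open>n\<close>. Rejection means
  that the standardized statistic falls into one of two half-lines, each with a one-point frontier
  that is null for the limit law.\<close>

lemma two_sided_tail_tendsto:
  fixes T :: "nat \<Rightarrow> 'a \<Rightarrow> real"
  assumes M: "\<And>n. prob_space (M n)" and T[measurable]: "\<And>n. T n \<in> borel_measurable (M n)"
    and \<sigma>: "0 < \<sigma>" and u: "0 \<le> u"
    and char: "\<And>s. (\<lambda>n. \<integral>\<omega>. iexp (s * T n \<omega>) \<partial>M n) \<longlonglongrightarrow> exp (\<i> * (s * \<theta>) - (s\<^sup>2 * \<sigma>\<^sup>2 / 2))"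
  shows "(\<lambda>n. \<integral>\<omega>. (if u * \<sigma> < \<bar>T n \<omega>\<bar> then 1 else 0) \<partial>M n) \<longlonglongrightarrow> \<Phi> (\<theta> / \<sigma> - u) + \<Phi> (- \<theta> / \<sigma> - u)"
proof -
  define Z where "Z n \<omega> = (T n \<omega> - \<theta>) / \<sigma>" for n \<omega>
  have Z[measurable]: "Z n \<in> borel_measurable (M n)" for n
    unfolding Z_def by measurable
  define D where "D n = distr (M n) borel (Z n)" for n
  have D: "real_distribution (D n)" for n
    unfolding D_def by (rule prob_space.real_distribution_distr[OF M Z])
  have wc: "weak_conv_m D std_normal_distribution"
  proof (rule levy_continuity[OF D real_dist_normal_dist])
    fix s
    have c: "char (D n) s = iexp (- (s * \<theta> / \<sigma>)) * (\<integral>\<omega>. iexp (s / \<sigma> * T n \<omega>) \<partial>M n)" for n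
    proof -
      have "char (D n) s = (\<integral>\<omega>. iexp (s * Z n \<omega>) \<partial>M n)"
        unfolding D_def char_def by (subst integral_distr) auto
      also have "\<dots> = (\<integral>\<omega>. iexp (- (s * \<theta> / \<sigma>)) * iexp (s / \<sigma> * T n \<omega>) \<partial>M n)"
        by (rule Bochner_Integration.integral_cong)
          (simp_all add: Z_def exp_add[symmetric] algebra_simps diff_divide_distrib)
      finally show ?thesis by simp
    qed
    have lim: "(\<lambda>n. iexp (- (s * \<theta> / \<sigma>)) * (\<integral>\<omega>. iexp (s / \<sigma> * T n \<omega>) \<partial>M n))
        \<longlonglongrightarrow> iexp (- (s * \<theta> / \<sigma>)) * exp (\<i> * ((s / \<sigma>) * \<theta>) - ((s / \<sigma>)\<^sup>2 * \<sigma>\<^sup>2 / 2))"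
      using char[of "s / \<sigma>"] by (intro tendsto_intros) (simp add: of_real_divide)
    have eq: "iexp (- (s * \<theta> / \<sigma>)) * exp (\<i> * ((s / \<sigma>) * \<theta>) - ((s / \<sigma>)\<^sup>2 * \<sigma>\<^sup>2 / 2))
        = char std_normal_distribution s"
      using \<sigma> by (simp add: char_std_normal_distribution exp_add[symmetric] power_divide exp_of_real[symmetric])
    show "(\<lambda>n. char (D n) s) \<longlonglongrightarrow> char std_normal_distribution s"
      unfolding c eq[symmetric] by (rule lim)
  qed
  have conv: "(\<lambda>n. measure (D n) A) \<longlonglongrightarrow> measure std_normal_distribution A"
    if "A \<in> sets borel" "frontier A = {x}" for A x
    by (rule weak_conv_imp_continuity_set_conv[OF D real_dist_normal_dist wc])
       (use that in \<open>auto simp: std_normal_singleton\<close>)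
  \<comment> \<open>\<open>l\<close> and \<open>b\<close> are the critical values
    \<open>- u * \<sigma>\<close> and \<open>u * \<sigma>\<close> after subtracting \<theta> and
    dividing by \<sigma>.\<close>
  define l where "l = - \<theta> / \<sigma> - u"
  define b where "b = u - \<theta> / \<sigma>"
  have "(\<lambda>n. measure (D n) {..<l}) \<longlonglongrightarrow> measure std_normal_distribution {..<l}"
    by (rule conv[where x=l]) (auto simp: frontier_def interior_open)
  then have 1: "(\<lambda>n. measure (D n) {..<l}) \<longlonglongrightarrow> \<Phi> (- \<theta> / \<sigma> - u)"
    by (simp add: std_normal_lessThan l_def)
  have "(\<lambda>n. measure (D n) {b<..}) \<longlonglongrightarrow> measure std_normal_distribution {b<..}"
    by (rule conv[where x=b]) (auto simp: frontier_def interior_open)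
  then have 2: "(\<lambda>n. measure (D n) {b<..}) \<longlonglongrightarrow> \<Phi> (\<theta> / \<sigma> - u)"
    by (simp add: std_normal_greaterThan b_def)
  have eq: "(\<integral>\<omega>. (if u * \<sigma> < \<bar>T n \<omega>\<bar> then 1 else 0) \<partial>M n) = measure (D n) {b<..} + measure (D n) {..<l}" for n
  proof -
    interpret D: real_distribution "D n" by (rule D)
    have iff: "u * \<sigma> < \<bar>T n \<omega>\<bar> \<longleftrightarrow> Z n \<omega> \<in> {b<..} \<union> {..<l}" for \<omega>
    proof -
      have "T n \<omega> = \<sigma> * (Z n \<omega> + \<theta> / \<sigma>)" using \<sigma> by (simp add: Z_def field_simps)
      then have "u * \<sigma> < \<bar>T n \<omega>\<bar> \<longleftrightarrow> \<sigma> * u < \<sigma> * \<bar>Z n \<omega> + \<theta> / \<sigma>\<bar>"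
        using \<sigma> by (simp only: abs_mult mult.commute[of u]) simp
      also have "\<dots> \<longleftrightarrow> u < \<bar>Z n \<omega> + \<theta> / \<sigma>\<bar>" using \<sigma> by simp
      also have "\<dots> \<longleftrightarrow> Z n \<omega> \<in> {b<..} \<union> {..<l}" by (auto simp: b_def l_def)
      finally show ?thesis .
    qed
    have "(\<integral>\<omega>. (if u * \<sigma> < \<bar>T n \<omega>\<bar> then 1 else 0) \<partial>M n) = (\<integral>\<omega>. indicat_real ({b<..} \<union> {..<l}) (Z n \<omega>) \<partial>M n)"
      by (rule Bochner_Integration.integral_cong) (auto simp: iff indicator_def)
    also have "\<dots> = (\<integral>x. indicat_real ({b<..} \<union> {..<l}) x \<partial>D n)"
      unfolding D_def by (subst integral_distr) auto
    also have "\<dots> = measure (D n) ({b<..} \<union> {..<l})"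
      by simp
    also have "\<dots> = measure (D n) {b<..} + measure (D n) {..<l}"
      using u by (intro D.finite_measure_Union) (auto simp: b_def l_def)
    finally show ?thesis .
  qed
  show ?thesis unfolding eq by (rule tendsto_add[OF 2 1])
qed

subsection \<open>Powers of characteristic functions along differentiable curves\<close>

text \<open>Here \<open>t n\<close> behaves like \<open>c / sqrt n\<close> and \<open>m n\<close>
  like \<open>p * n\<close>. With \<open>a = s * sqrt n / m\<close> this gives
  \<open>m * a\<^sup>2 \<longlonglongrightarrow> s\<^sup>2 / p\<close>,
  \<open>m * a * t \<longlonglongrightarrow> s * c\<close> and
  \<open>m * t\<^sup>2 \<longlonglongrightarrow> p * c\<^sup>2\<close>, while the two little-o
  conditions on the curve make the remaining terms of \<open>char_perturbation_tendsto\<close>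
  vanish. The limit of \<open>m * (z - 1)\<close> then passes to \<open>z ^ m\<close>.\<close>

lemma curve_char_power_tendsto:
  fixes h g :: "'a \<Rightarrow> real" and t :: "nat \<Rightarrow> real" and m :: "nat \<Rightarrow> nat"
  assumes curve: "L2_differentiable_curve \<R> \<epsilon> f g"
    and prob: "\<And>S. S \<in> \<R> \<Longrightarrow> prob_space S" and sets: "\<And>S. S \<in> \<R> \<Longrightarrow> sets S = sets (f 0)"
    and t\<epsilon>: "\<And>n. \<bar>t n\<bar> < \<epsilon>" and t0: "filterlim t (at 0) sequentially"
    and tc: "(\<lambda>n. t n * sqrt (real n)) \<longlonglongrightarrow> c"
    and h: "h \<in> L2_0 (f 0)" and m: "(\<lambda>n. real (m n) / real n) \<longlonglongrightarrow> p" and p: "0 < p"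
  shows "(\<lambda>n. (\<integral>x. iexp (s * (sqrt (real n) / m n) * h x) \<partial>f (t n)) ^ m n)
    \<longlonglongrightarrow> exp (\<i> * (s * c * (\<integral>x. h x * g x \<partial>f 0)) - s\<^sup>2 / p / 2 * (\<integral>x. (h x)\<^sup>2 \<partial>f 0))"
proof -
  have \<epsilon>: "0 < \<epsilon>" and mem: "\<And>t. \<bar>t\<bar> < \<epsilon> \<Longrightarrow> f t \<in> \<R>" and g: "g \<in> L2 (f 0)"
    using curve by (auto simp: L2_differentiable_curve_def)
  obtain L where L: "\<And>t. \<bar>t\<bar> < \<epsilon> \<Longrightarrow> is_density_quotient (f t) (f 0) (L t)"
    and Lr: "(\<lambda>t. norm_L2 (f 0) (\<lambda>x. 2 * (sqrt (enn2real (L t x)) - 1) - t * g x)) \<in> o[at 0](\<lambda>t. \<bar>t\<bar>)"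
    and Ls: "(\<lambda>t. measure (f t) {x \<in> space (f t). L t x = \<infinity>}) \<in> o[at 0](\<lambda>t. t\<^sup>2)"
    using curve unfolding L2_differentiable_curve_def by blast
  define r where "r t = norm_L2 (f 0) (\<lambda>x. 2 * (sqrt (enn2real (L t x)) - 1) - t * g x)" for t
  define q where "q t = measure (f t) {x \<in> space (f t). L t x = \<infinity>}" for t
  have t_nz: "\<forall>\<^sub>F n in sequentially. t n \<noteq> 0"
    using t0 by (simp add: filterlim_at)
  have nt: "(\<lambda>n. real n * (t n)\<^sup>2) \<longlonglongrightarrow> c\<^sup>2"
    using tendsto_power[OF tc, of 2] by (simp add: power_mult_distrib mult.commute)
  \<comment> \<open>The rates in \<open>t\<close> are converted into rates in \<open>n\<close> by
    multiplying with the convergent sequence \<open>n * t\<^sup>2\<close>; the cancellation needs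
    \<open>t n \<noteq> 0\<close>, which holds eventually.\<close>
  have "(\<lambda>n. r (t n) / \<bar>t n\<bar>) \<longlonglongrightarrow> 0"
    using smalloD_tendsto[OF Lr] t0 unfolding r_def by (rule filterlim_compose)
  from tendsto_mult[OF tendsto_power[OF this, of 2] nt]
  have "(\<lambda>n. (r (t n) / \<bar>t n\<bar>)\<^sup>2 * (real n * (t n)\<^sup>2)) \<longlonglongrightarrow> 0" by simp
  then have nr: "(\<lambda>n. real n * (r (t n))\<^sup>2) \<longlonglongrightarrow> 0"
    by (rule Lim_transform_eventually) (use t_nz in \<open>eventually_elim, simp add: power_divide\<close>)
  have "(\<lambda>n. q (t n) / (t n)\<^sup>2) \<longlonglongrightarrow> 0"
    using smalloD_tendsto[OF Ls] t0 unfolding q_def by (rule filterlim_compose)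
  from tendsto_mult[OF this nt]
  have "(\<lambda>n. q (t n) / (t n)\<^sup>2 * (real n * (t n)\<^sup>2)) \<longlonglongrightarrow> 0" by simp
  then have nq: "(\<lambda>n. real n * q (t n)) \<longlonglongrightarrow> 0"
    by (rule Lim_transform_eventually) (use t_nz in \<open>eventually_elim, simp\<close>)
  have pos: "\<forall>\<^sub>F n in sequentially. (0::nat) < n" by (rule eventually_gt_at_top)
  have scale: "(\<lambda>n. real (m n) * y n) \<longlonglongrightarrow> p * z" if "(\<lambda>n. real n * y n) \<longlonglongrightarrow> z" for y z
    by (rule Lim_transform_eventually[OF tendsto_mult[OF m that]])
       (use pos in \<open>eventually_elim, simp\<close>)

  have m_top: "filterlim (\<lambda>n. real (m n)) at_top sequentially"
    by (rule filterlim_mono_eventually[OF filterlim_tendsto_pos_mult_at_top[OF m p filterlim_real_sequentially] order_refl order_refl])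
       (use pos in \<open>eventually_elim, simp\<close>)
  then have m_top': "filterlim m at_top sequentially"
    unfolding filterlim_at_top by (metis (no_types, lifting) eventually_mono of_nat_le_iff)
  have m_pos: "\<forall>\<^sub>F n in sequentially. 0 < m n"
    using m_top'[unfolded filterlim_at_top, rule_format, of 1] by (rule eventually_mono) simp

  define a where "a n = s * (sqrt (real n) / m n)" for n
  have nm: "(\<lambda>n. real n / real (m n)) \<longlonglongrightarrow> 1 / p"
    using tendsto_divide[OF tendsto_const[of 1] m] p by simp
  \<comment> \<open>\<open>a n\<close> is the product of \<open>n / m n\<close>,
    \<open>1 / sqrt n\<close> and \<open>s\<close>, because \<open>n / sqrt n = sqrt n\<close>, also
    at \<open>n = 0\<close>.\<close>
  have "(\<lambda>n. inverse (sqrt (real n))) \<longlonglongrightarrow> 0"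
    by (rule tendsto_inverse_0_at_top[OF filterlim_compose[OF sqrt_at_top filterlim_real_sequentially]])
  from tendsto_mult[OF tendsto_mult[OF nm this] tendsto_const[of s]]
  have "(\<lambda>n. real n / real (m n) * inverse (sqrt (real n)) * s) \<longlonglongrightarrow> 0" by simp
  moreover have "real n / real (m n) * inverse (sqrt (real n)) * s = s * (real n / sqrt (real n) / m n)" for n
    by (simp add: divide_inverse mult_ac)
  ultimately have "(\<lambda>n. s * (real n / sqrt (real n) / m n)) \<longlonglongrightarrow> 0"
    by (simp only:)
  then have a0: "a \<longlonglongrightarrow> 0"
    by (simp only: a_def[abs_def] real_div_sqrt of_nat_0_le_iff)
  have maa: "(\<lambda>n. real (m n) * (a n)\<^sup>2) \<longlonglongrightarrow> s\<^sup>2 / p"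
    by (rule Lim_transform_eventually[OF tendsto_mult_left[OF nm, of "s\<^sup>2", simplified]])
       (use m_pos in \<open>eventually_elim, simp add: a_def power_mult_distrib power_divide power2_eq_square[of "real (m _)"]\<close>)
  have mat: "(\<lambda>n. real (m n) * a n * t n) \<longlonglongrightarrow> s * c"
    by (rule Lim_transform_eventually[OF tendsto_mult_left[OF tc, of s]])
       (use m_pos in \<open>eventually_elim, simp add: a_def\<close>)

  have f0: "f 0 \<in> \<R>" using mem[of 0] \<epsilon> by simp
  define z where "z n = (\<integral>x. iexp (a n * h x) \<partial>f (t n))" for n
  define w where "w = \<i> * (s * c * (\<integral>x. h x * g x \<partial>f 0)) - s\<^sup>2 / p / 2 * (\<integral>x. (h x)\<^sup>2 \<partial>f 0)"
  have h_meas: "h \<in> borel_measurable (f (t n))" for n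
    using h measurable_cong_sets[OF sets[OF mem[OF t\<epsilon>[of n]]] refl] by (auto simp: L2_0_def L2_def)
  have z_minus_1: "(\<integral>x. iexp (a n * h x) - 1 \<partial>f (t n)) = z n - 1" for n
  proof -
    interpret S: prob_space "f (t n)" by (rule prob[OF mem[OF t\<epsilon>]])
    note [measurable] = h_meas[of n]
    have "integrable (f (t n)) (\<lambda>x. iexp (a n * h x))"
      by (rule S.integrable_const_bound[where B=1]) auto
    then show ?thesis unfolding z_def by (simp add: S.prob_space)
  qed
  have "(\<lambda>n. real (m n) * (\<integral>x. iexp (a n * h x) - 1 \<partial>f (t n)))
    \<longlonglongrightarrow> \<i> * ((s * c) * (\<integral>x. h x * g x \<partial>f 0)) - (s\<^sup>2 / p) / 2 * (\<integral>x. (h x)\<^sup>2 \<partial>f 0)"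
  proof (rule char_perturbation_tendsto[where L="\<lambda>n. L (t n)" and \<tau>=t and b="p * c\<^sup>2"])
    show "(\<lambda>n. real (m n) * (norm_L2 (f 0) (\<lambda>x. 2 * (sqrt (enn2real (L (t n) x)) - 1) - t n * g x))\<^sup>2) \<longlonglongrightarrow> 0"
      using scale[OF nr] by (simp add: r_def)
    show "(\<lambda>n. real (m n) * measure (f (t n)) {x \<in> space (f (t n)). L (t n) x = \<infinity>}) \<longlonglongrightarrow> 0"
      using scale[OF nq] by (simp add: q_def)
    show "(\<lambda>n. real (m n) * (t n)\<^sup>2) \<longlonglongrightarrow> p * c\<^sup>2"
      by (rule scale[OF nt])
    show "sets (f (t n)) = sets (f 0)" for n by (rule sets[OF mem[OF t\<epsilon>]])
    show "is_density_quotient (f (t n)) (f 0) (L (t n))" for n by (rule L[OF t\<epsilon>])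
    show "prob_space (f (t n))" for n by (rule prob[OF mem[OF t\<epsilon>]])
  qed (use prob[OF f0] h g a0 maa mat in simp_all)
  then have lim: "(\<lambda>n. m n * (z n - 1)) \<longlonglongrightarrow> w"
    unfolding z_minus_1 w_def by (simp add: mult_ac)
  have "(\<lambda>n. z n ^ m n) \<longlonglongrightarrow> exp w"
  proof (rule power_tendsto_exp[OF _ _ m_top' lim])
    fix n
    interpret S: prob_space "f (t n)" by (rule prob[OF mem[OF t\<epsilon>]])
    have "cmod (z n) \<le> (\<integral>x. cmod (iexp (a n * h x)) \<partial>f (t n))"
      unfolding z_def by (rule integral_norm_bound)
    then show "cmod (z n) \<le> 1" by (simp add: S.prob_space)
  next
    have "0 \<le> s\<^sup>2 / p / 2 * (\<integral>x. (h x)\<^sup>2 \<partial>f 0)"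
      using p by simp
    then show "Re w \<le> 0" by (simp add: w_def)
  qed
  then show ?thesis by (simp add: z_def a_def w_def)
qed

subsection \<open>Power of the test\<close>

lemma integral_fst_prob:
  fixes f :: "'a \<Rightarrow> complex"
  assumes "prob_space P" "prob_space Q" "f \<in> borel_measurable P" "\<And>x. cmod (f x) \<le> 1"
  shows "(\<integral>\<omega>. f (fst \<omega>) \<partial>(P \<Otimes>\<^sub>M Q)) = (\<integral>x. f x \<partial>P)"
  using integral_pair_mult[OF assms(1-3), of "\<lambda>_. 1"] assms(4) prob_space.prob_space[OF assms(2)] by simp

lemma integral_snd_prob:
  fixes f :: "'b \<Rightarrow> complex"
  assumes "prob_space P" "prob_space Q" "f \<in> borel_measurable Q" "\<And>x. cmod (f x) \<le> 1"
  shows "(\<integral>\<omega>. f (snd \<omega>) \<partial>(P \<Otimes>\<^sub>M Q)) = (\<integral>x. f x \<partial>Q)"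
  using integral_pair_mult[OF assms(1,2) _ assms(3), of "\<lambda>_. 1"] assms(4) prob_space.prob_space[OF assms(1)] by simp

lemma distr_pair_snd:
  assumes "prob_space P" "prob_space Q"
  shows "distr (P \<Otimes>\<^sub>M Q) Q snd = Q"
proof -
  interpret P: prob_space P by fact
  interpret Q: prob_space Q by fact
  interpret pair_sigma_finite P Q ..
  have "distr (P \<Otimes>\<^sub>M Q) Q snd = distr (distr (Q \<Otimes>\<^sub>M P) (P \<Otimes>\<^sub>M Q) (\<lambda>(x, y). (y, x))) Q snd"
    by (rule arg_cong[where f="\<lambda>M. distr M Q snd"]) (rule distr_pair_swap)
  also have "\<dots> = distr (Q \<Otimes>\<^sub>M P) Q (snd \<circ> (\<lambda>(x, y). (y, x)))"
    by (rule distr_distr) measurable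
  also have "snd \<circ> (\<lambda>(x, y). (y, x)) = fst" by auto
  finally show ?thesis using P.distr_pair_fst[of Q] by simp
qed

text \<open>Applied to the coordinate projections, this moves the two gradient components to the
  product space.\<close>

lemma L2_0_distr:
  assumes "distr M N X = N" and [measurable]: "X \<in> measurable M N" and "h \<in> L2_0 N"
  shows "(\<lambda>x. h (X x)) \<in> L2_0 M" "(\<integral>x. (h (X x))\<^sup>2 \<partial>M) = (\<integral>y. (h y)\<^sup>2 \<partial>N)"
proof -
  have [measurable]: "h \<in> borel_measurable N" and h: "integrable N (\<lambda>x. (h x)\<^sup>2)" "(\<integral>x. h x \<partial>N) = 0"
    using assms(3) by (auto simp: L2_0_def L2_def)
  have "integrable (distr M N X) (\<lambda>x. (h x)\<^sup>2)" "(\<integral>x. h x \<partial>distr M N X) = 0"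
    using h assms(1) by simp_all
  then have "integrable M (\<lambda>x. (h (X x))\<^sup>2)" "(\<integral>x. h (X x) \<partial>M) = 0"
    by (simp_all add: integrable_distr_eq integral_distr)
  then show "(\<lambda>x. h (X x)) \<in> L2_0 M"
    by (simp add: L2_0_def L2_def)
  have "(\<integral>y. (h y)\<^sup>2 \<partial>N) = (\<integral>y. (h y)\<^sup>2 \<partial>distr M N X)"
    using assms(1) by simp
  then show "(\<integral>x. (h (X x))\<^sup>2 \<partial>M) = (\<integral>y. (h y)\<^sup>2 \<partial>N)"
    by (simp add: integral_distr)
qed

theorem mainTheorem7:
  fixes \<Omega>1 :: "'a measure" and \<Omega>2 :: "'b measure"
    and \<P> :: "'a measure set" and \<Q> :: "'b measure set"
    and P\<^sub>0 :: "'a measure" and Q\<^sub>0 :: "'b measure"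
    and k :: "('a \<times> 'b) measure \<Rightarrow> real"
    and kt :: "'a \<times> 'b \<Rightarrow> real" and k1 :: "'a \<Rightarrow> real" and k2 :: "'b \<Rightarrow> real"
    and \<alpha> d :: real and n1 n2 :: "nat \<Rightarrow> nat"
    and Pn :: "nat \<Rightarrow> 'a measure" and Qn :: "nat \<Rightarrow> 'b measure"
  assumes "\<forall>P\<in>\<P>. prob_space P \<and> sets P = sets \<Omega>1"
    and "\<forall>Q\<in>\<Q>. prob_space Q \<and> sets Q = sets \<Omega>2"
    and "P\<^sub>0 \<in> \<P>" and "Q\<^sub>0 \<in> \<Q>"
    and "differentiable_functional k (product_family \<P> \<Q>) (P\<^sub>0 \<Otimes>\<^sub>M Q\<^sub>0)"
    and "is_canonical_gradient k (product_family \<P> \<Q>) (P\<^sub>0 \<Otimes>\<^sub>M Q\<^sub>0) kt"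
    and "k1 \<in> L2_0 P\<^sub>0" and "k2 \<in> L2_0 Q\<^sub>0"
    and "AE \<omega> in P\<^sub>0 \<Otimes>\<^sub>M Q\<^sub>0. kt \<omega> = k1 (fst \<omega>) + k2 (snd \<omega>)"
    and "(\<integral>\<omega>. (kt \<omega>)\<^sup>2 \<partial>(P\<^sub>0 \<Otimes>\<^sub>M Q\<^sub>0)) \<noteq> 0"
    and "0 < \<alpha>" and "\<alpha> < 1"
    and "\<forall>n. n1 n + n2 n = n"
    and "(\<lambda>n. real (n2 n) / real n) \<longlonglongrightarrow> d" and "0 < d" and "d < 1"
    and "\<forall>n. Pn n \<in> \<P>" and "\<forall>n. Qn n \<in> \<Q>"
    and "(\<lambda>n. Pn n \<Otimes>\<^sub>M Qn n) \<in> F2 \<P> \<Q> P\<^sub>0 Q\<^sub>0"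
  shows "let \<Delta> = (\<lambda>n. sqrt (real n) * (k (Pn n \<Otimes>\<^sub>M Qn n) - k (P\<^sub>0 \<Otimes>\<^sub>M Q\<^sub>0)));
             \<theta> = lim \<Delta>;
             \<sigma> = sigma1 d P\<^sub>0 Q\<^sub>0 k1 k2;
             u = normal_quantile (1 - \<alpha> / 2)
         in convergent \<Delta> \<and>
            (\<lambda>n. \<integral>\<omega>. psi \<alpha> \<sigma> (n1 n) (n2 n) k1 k2 \<omega>
                   \<partial>sample_measure (n1 n) (n2 n) (Pn n) (Qn n))
              \<longlonglongrightarrow> \<Phi> (\<theta> / \<sigma> - u) + \<Phi> (- \<theta> / \<sigma> - u)"
proof -
  let ?R = "P\<^sub>0 \<Otimes>\<^sub>M Q\<^sub>0" and ?F = "product_family \<P> \<Q>"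
  have P: "prob_space P" "sets P = sets \<Omega>1" if "P \<in> \<P>" for P using assms(1) that by auto
  have Q: "prob_space Q" "sets Q = sets \<Omega>2" if "Q \<in> \<Q>" for Q using assms(2) that by auto
  interpret P0: prob_space P\<^sub>0 by (rule P) fact
  interpret Q0: prob_space Q\<^sub>0 by (rule Q) fact
  interpret R: pair_prob_space P\<^sub>0 Q\<^sub>0 ..
  obtain t c \<epsilon> f g where t: "t \<longlonglongrightarrow> 0" and c: "0 < c" and tc: "(\<lambda>n. t n * sqrt (real n)) \<longlonglongrightarrow> c"
    and curve: "L2_differentiable_curve ?F \<epsilon> f g" and f0: "f 0 = ?R"
    and t\<epsilon>: "\<And>n. \<bar>t n\<bar> < \<epsilon>" and ft: "\<And>n. Pn n \<Otimes>\<^sub>M Qn n = f (t n)"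
    using assms(19) unfolding F2_def by blast
  have g: "g \<in> L2 ?R" using curve f0 by (simp add: L2_differentiable_curve_def)

  \<comment> \<open>The limit defining a gradient is one-sided, so the sign of \<open>t n\<close>
    matters; \<open>c > 0\<close> forces it to be positive eventually.\<close>
  have t_pos: "\<forall>\<^sub>F n in sequentially. 0 < t n"
    using order_tendstoD(1)[OF tc c]
    by (rule eventually_mono) (metis mult_nonpos_nonneg not_le real_sqrt_ge_zero of_nat_0_le_iff)
  have t_right: "filterlim t (at_right 0) sequentially"
    using t t_pos by (auto simp: filterlim_at elim: eventually_mono)
  have t_at: "filterlim t (at 0) sequentially"
    using t t_pos by (auto simp: filterlim_at elim: eventually_mono)

  \<comment> \<open>Gradient components on the product space\<close>
  define V1 where "V1 = (\<integral>x. (k1 x)\<^sup>2 \<partial>P\<^sub>0)"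
  define V2 where "V2 = (\<integral>y. (k2 y)\<^sup>2 \<partial>Q\<^sub>0)"
  \<comment> \<open>The components are lifted because the curve and its tangent \<open>g\<close>
    describe the joint law, not the two marginals.\<close>
  define h1 where "h1 \<omega> = k1 (fst \<omega>)" for \<omega> :: "'a \<times> 'b"
  define h2 where "h2 \<omega> = k2 (snd \<omega>)" for \<omega> :: "'a \<times> 'b"
  have h1: "h1 \<in> L2_0 ?R" "(\<integral>\<omega>. (h1 \<omega>)\<^sup>2 \<partial>?R) = V1"
    unfolding h1_def[abs_def] V1_def
    using L2_0_distr[OF Q0.distr_pair_fst measurable_fst assms(7)] by auto
  have h2: "h2 \<in> L2_0 ?R" "(\<integral>\<omega>. (h2 \<omega>)\<^sup>2 \<partial>?R) = V2"
    unfolding h2_def[abs_def] V2_def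
    using L2_0_distr[OF distr_pair_snd[OF P0.prob_space_axioms Q0.prob_space_axioms] measurable_snd assms(8)] by auto
  have hL: "h1 \<in> L2 ?R" "h2 \<in> L2 ?R" using h1 h2 by (auto simp: L2_0_def)
  have kt_grad: "is_gradient k ?F ?R kt"
    using assms(6) by (simp add: is_canonical_gradient_def)
  then have ktL: "kt \<in> L2 ?R" by (simp add: is_gradient_def L2_0_def)
  have [measurable]: "h1 \<in> borel_measurable ?R" "h2 \<in> borel_measurable ?R" "kt \<in> borel_measurable ?R" "g \<in> borel_measurable ?R"
    using hL ktL g by (auto simp: L2_def)
  have kt_eq: "AE \<omega> in ?R. kt \<omega> = h1 \<omega> + h2 \<omega>" using assms(9) by (simp add: h1_def h2_def)

  define A1 where "A1 = (\<integral>\<omega>. h1 \<omega> * g \<omega> \<partial>?R)"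
  define A2 where "A2 = (\<integral>\<omega>. h2 \<omega> * g \<omega> \<partial>?R)"
  have "(\<integral>\<omega>. kt \<omega> * g \<omega> \<partial>?R) = (\<integral>\<omega>. h1 \<omega> * g \<omega> + h2 \<omega> * g \<omega> \<partial>?R)"
    using kt_eq by (intro integral_cong_AE) (auto simp: distrib_right)
  also have "\<dots> = A1 + A2"
    unfolding A1_def A2_def
    by (intro Bochner_Integration.integral_add L2_integrable_mult hL g)
  finally have A: "(\<integral>\<omega>. kt \<omega> * g \<omega> \<partial>?R) = A1 + A2" .

  \<comment> \<open>Limit of the local parameter\<close>
  define \<Delta> where "\<Delta> n = sqrt (real n) * (k (Pn n \<Otimes>\<^sub>M Qn n) - k ?R)" for n
  define \<theta> where "\<theta> = c * (A1 + A2)"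
  have "((\<lambda>t. (k (f t) - k ?R) / t) \<longlongrightarrow> A1 + A2) (at_right 0)"
    using kt_grad curve f0 unfolding is_gradient_def A[symmetric] by blast
  \<comment> \<open>\<Delta> is the product of \<open>t n * sqrt n\<close>, with limit
    \<open>c\<close>, and the difference quotient of \<open>k\<close> along the curve, with limit
    \<open>A1 + A2\<close>.\<close>
  from tendsto_mult[OF tc filterlim_compose[OF this t_right]]
  have \<Delta>: "\<Delta> \<longlonglongrightarrow> \<theta>"
    unfolding \<theta>_def
    by (rule Lim_transform_eventually)
       (use t_pos in \<open>eventually_elim, simp add: \<Delta>_def ft\<close>)

  \<comment> \<open>Positivity of the asymptotic variance\<close>
  define \<sigma> where "\<sigma> = sigma1 d P\<^sub>0 Q\<^sub>0 k1 k2"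
  have V: "0 \<le> V1" "0 \<le> V2" unfolding V1_def V2_def by simp_all
  have \<sigma>2: "\<sigma>\<^sup>2 = V1 / (1 - d) + V2 / d"
    using V assms(15,16) by (simp add: \<sigma>_def sigma1_def V1_def[symmetric] V2_def[symmetric])
  \<comment> \<open>If both second moments vanished,
    \<open>(x + y)\<^sup>2 \<le> 2 * x\<^sup>2 + 2 * y\<^sup>2\<close> would make the second moment
    of \<open>kt\<close> vanish as well.\<close>
  have "0 < V1 + V2"
  proof -
    have "(\<integral>\<omega>. (kt \<omega>)\<^sup>2 \<partial>?R) \<le> (\<integral>\<omega>. 2 * (h1 \<omega>)\<^sup>2 + 2 * (h2 \<omega>)\<^sup>2 \<partial>?R)"
    proof (rule integral_mono_AE)
      show "integrable ?R (\<lambda>\<omega>. (kt \<omega>)\<^sup>2)" "integrable ?R (\<lambda>\<omega>. 2 * (h1 \<omega>)\<^sup>2 + 2 * (h2 \<omega>)\<^sup>2)"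
        using ktL hL by (auto simp: L2_def)
      have "(x + y)\<^sup>2 \<le> 2 * x\<^sup>2 + 2 * y\<^sup>2" for x y :: real
        using zero_le_power2[of "x - y"] unfolding power2_sum power2_diff by linarith
      then show "AE \<omega> in ?R. (kt \<omega>)\<^sup>2 \<le> 2 * (h1 \<omega>)\<^sup>2 + 2 * (h2 \<omega>)\<^sup>2"
        using kt_eq by (auto elim!: eventually_mono)
    qed
    also have "\<dots> = 2 * V1 + 2 * V2"
      using hL h1(2) h2(2) by (simp add: L2_def)
    finally have "(\<integral>\<omega>. (kt \<omega>)\<^sup>2 \<partial>?R) \<le> 2 * V1 + 2 * V2" .
    moreover have "0 \<le> (\<integral>\<omega>. (kt \<omega>)\<^sup>2 \<partial>?R)" by simp
    ultimately show ?thesis using assms(10) by linarith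
  qed
  then have "0 < V1 \<or> 0 < V2" using V by linarith
  then have "0 < \<sigma>\<^sup>2"
    unfolding \<sigma>2 using V assms(15,16) by (auto intro: add_pos_nonneg add_nonneg_pos)
  moreover have "0 \<le> \<sigma>"
    using V assms(15,16) by (simp add: \<sigma>_def sigma1_def V1_def[symmetric] V2_def[symmetric])
  ultimately have \<sigma>: "0 < \<sigma>" by (simp add: order_less_le)

  have n2: "(\<lambda>n. real (n2 n) / real n) \<longlonglongrightarrow> d" by fact
  have n1: "(\<lambda>n. real (n1 n) / real n) \<longlonglongrightarrow> 1 - d"
  proof (rule Lim_transform_eventually)
    show "(\<lambda>n. 1 - real (n2 n) / real n) \<longlonglongrightarrow> 1 - d" by (intro tendsto_intros n2)
    \<comment> \<open>At \<open>n = 0\<close> the quotients are 0 by convention and the identity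
      would read \<open>1 = 0\<close>.\<close>
    have "1 - real (n2 n) / real n = real (n1 n) / real n" if "0 < n" for n
    proof -
      have "real n = real (n1 n) + real (n2 n)" using assms(13) by (metis of_nat_add)
      then show ?thesis using that by (simp add: field_simps)
    qed
    then show "\<forall>\<^sub>F n in sequentially. 1 - real (n2 n) / real n = real (n1 n) / real n"
      by (rule eventually_mono[OF eventually_gt_at_top[of "0::nat"]])
  qed

  \<comment> \<open>Common measurable structure along the curve\<close>
  have famP: "prob_space S" if "S \<in> ?F" for S
  proof -
    obtain P' Q' where S: "S = P' \<Otimes>\<^sub>M Q'" "P' \<in> \<P>" "Q' \<in> \<Q>" using \<open>S \<in> ?F\<close> by (auto simp: product_family_def)
    interpret P': prob_space P' by (rule P) fact
    interpret Q': prob_space Q' by (rule Q) fact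
    interpret pair_prob_space P' Q' ..
    show ?thesis unfolding S(1) by (rule P.prob_space_axioms)
  qed
  have famS: "sets S = sets (f 0)" if "S \<in> ?F" for S
  proof -
    obtain P' Q' where S: "S = P' \<Otimes>\<^sub>M Q'" "P' \<in> \<P>" "Q' \<in> \<Q>" using \<open>S \<in> ?F\<close> by (auto simp: product_family_def)
    show ?thesis unfolding S(1) f0
      using P(2)[OF S(2)] Q(2)[OF S(3)] P(2)[OF assms(3)] Q(2)[OF assms(4)]
      by (intro sets_pair_measure_cong) simp_all
  qed
  have Pn: "prob_space (Pn n)" and Qn: "prob_space (Qn n)" for n
    using P Q assms(17,18) by auto
  have k1_meas: "k1 \<in> borel_measurable (Pn n)" for n
    using assms(7) P(2)[OF assms(17)[rule_format, of n]] P(2)[OF assms(3)]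
    by (simp add: L2_0_def L2_def cong: measurable_cong_sets)
  have k2_meas: "k2 \<in> borel_measurable (Qn n)" for n
    using assms(8) Q(2)[OF assms(18)[rule_format, of n]] Q(2)[OF assms(4)]
    by (simp add: L2_0_def L2_def cong: measurable_cong_sets)

  \<comment> \<open>Limit of the characteristic function of the statistic\<close>
  have char_lim: "(\<lambda>n. \<integral>\<omega>. iexp (s * T_stat (n1 n) (n2 n) k1 k2 \<omega>) \<partial>sample_measure (n1 n) (n2 n) (Pn n) (Qn n))
      \<longlonglongrightarrow> exp (\<i> * (s * \<theta>) - (s\<^sup>2 * \<sigma>\<^sup>2 / 2))" for s
  proof -
    have 1: "(\<lambda>n. (\<integral>\<omega>. iexp (s * (sqrt (real n) / n1 n) * h1 \<omega>) \<partial>f (t n)) ^ n1 n)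
        \<longlonglongrightarrow> exp (\<i> * (s * c * A1) - s\<^sup>2 / (1 - d) / 2 * V1)"
      using curve_char_power_tendsto[OF curve famP famS t\<epsilon> t_at tc, of h1 n1 "1 - d" s] h1 n1 assms(16)
      by (simp add: f0 A1_def)
    have 2: "(\<lambda>n. (\<integral>\<omega>. iexp (s * (sqrt (real n) / n2 n) * h2 \<omega>) \<partial>f (t n)) ^ n2 n)
        \<longlonglongrightarrow> exp (\<i> * (s * c * A2) - s\<^sup>2 / d / 2 * V2)"
      using curve_char_power_tendsto[OF curve famP famS t\<epsilon> t_at tc, of h2 n2 d s] h2 n2 assms(15)
      by (simp add: f0 A2_def)
    \<comment> \<open>The marginals of \<open>f (t n)\<close> are \<open>Pn n\<close> and
      \<open>Qn n\<close>, so each one-sample integral equals an integral of a lifted function under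
      the joint law, where the limits \<open>1\<close> and \<open>2\<close> apply.\<close>
    have "(\<integral>\<omega>. iexp (s * T_stat (n1 n) (n2 n) k1 k2 \<omega>) \<partial>sample_measure (n1 n) (n2 n) (Pn n) (Qn n))
      = (\<integral>\<omega>. iexp (s * (sqrt (real n) / n1 n) * h1 \<omega>) \<partial>f (t n)) ^ n1 n
        * (\<integral>\<omega>. iexp (s * (sqrt (real n) / n2 n) * h2 \<omega>) \<partial>f (t n)) ^ n2 n" for n
    proof -
      note [measurable] = k1_meas[of n] k2_meas[of n]
      have "(\<integral>\<omega>. iexp (s * (sqrt (real n) / n1 n) * h1 \<omega>) \<partial>f (t n)) = (\<integral>x. iexp (s * (sqrt (real n) / n1 n) * k1 x) \<partial>Pn n)"
        unfolding ft[symmetric] h1_def by (rule integral_fst_prob[OF Pn Qn]) auto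
      moreover have "(\<integral>\<omega>. iexp (s * (sqrt (real n) / n2 n) * h2 \<omega>) \<partial>f (t n)) = (\<integral>x. iexp (s * (sqrt (real n) / n2 n) * k2 x) \<partial>Qn n)"
        unfolding ft[symmetric] h2_def by (rule integral_snd_prob[OF Pn Qn]) auto
      ultimately show ?thesis
        using char_T_stat[OF Pn Qn k1_meas k2_meas, where s=s and ?m1.0="n1 n" and ?m2.0="n2 n"] assms(13) by simp
    qed
    \<comment> \<open>The shifts add up to \<open>s * \<theta>\<close>, and the variances, weighted
      by the inverse sample fractions, to \<open>\<sigma>\<^sup>2\<close>.\<close>
    moreover have "\<i> * (s * c * A1) - s\<^sup>2 / (1 - d) / 2 * V1 + (\<i> * (s * c * A2) - s\<^sup>2 / d / 2 * V2)
        = \<i> * (s * \<theta>) - (s\<^sup>2 * \<sigma>\<^sup>2 / 2)"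
      by (simp add: complex_eq_iff \<sigma>2 \<theta>_def algebra_simps add_divide_distrib)
    ultimately show ?thesis
      using tendsto_mult[OF 1 2] by (simp only: exp_add[symmetric])
  qed

  \<comment> \<open>Asymptotic rejection probability\<close>
  define u where "u = normal_quantile (1 - \<alpha> / 2)"
  have u: "0 \<le> u"
    unfolding u_def using assms(11,12) by (intro normal_quantile_nonneg) auto
  have "(\<lambda>n. \<integral>\<omega>. (if u * \<sigma> < \<bar>T_stat (n1 n) (n2 n) k1 k2 \<omega>\<bar> then 1 else 0) \<partial>sample_measure (n1 n) (n2 n) (Pn n) (Qn n))
    \<longlonglongrightarrow> \<Phi> (\<theta> / \<sigma> - u) + \<Phi> (- \<theta> / \<sigma> - u)"
    by (rule two_sided_tail_tendsto[OF prob_space_sample_measure[OF Pn Qn] T_stat_measurable[OF k1_meas k2_meas] \<sigma> u char_lim])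
  moreover have "lim \<Delta> = \<theta>" "convergent \<Delta>"
    using \<Delta> by (auto intro: limI convergentI)
  ultimately show ?thesis
    unfolding Let_def psi_def \<Delta>_def[abs_def, symmetric] \<sigma>_def[symmetric] u_def[symmetric]
    by simp
qed

end
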